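(* Let $\mathbb{H}_\infty=\{(z_1,z_2)\in\mathbb{C}^2 : |z_1|<e^{-1/|z_2|},\ z_2\in\mathbb{D}^*\}$ be the exponential Hartogs triangle, where $\mathbb{D}^*=\{z\in\mathbb{C}:0<|z|<1\}$. The Friedrichs operator \[ \mathbf{F}:A^2(\mathbb{H}_\infty)\to A^p(\mathbb{H}_\infty) \] is bounded for every $p\in[2,\infty)$, but not for $p=\infty$ (where the target space is $H^\infty(\mathbb{H}_\infty)$).
   Context: For a bounded domain $\Omega\subset\mathbb{C}^n$, $\mathcal{O}(\Omega)$ is the space of holomorphic functions on $\Omega$; for $1\le p<\infty$, $A^p(\Omega)=L^p(\Omega)\cap\mathcal{O}(\Omega)$ (with respect to Lebesgue measure, with the $L^p$ norm), and $H^\infty(\Omega)=L^\infty(\Omega)\cap\mathcal{O}(\Omega)$ plays this role for $p=\infty$. The Bergman projection $\mathbf{B}$ is the orthogonal projection from $L^2(\Omega)$ onto $A^2(\Omega)$. The Friedrichs operator is the conjugate-linear map $\mathbf{F}:A^2(\Omega)\to A^2(\Omega)$, $\mathbf{F}(g)=\mathbf{B}(\overline{g})$. An operator $T:X\to Y$ is bounded if it maps $X$ into $Y$ with $\|Tx\|_Y\le C\|x\|_X$ for some constant $C$ and all $x\in X$. *)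

theory Defs
  imports "HOL-Analysis.Analysis" "HOL-Probability.Essential_Supremum"
begin

type_synonym complex2 = "complex \<times> complex"

text \<open>Differentiability is in the Frechet sense with a complex-linear derivative; the derivative
  \<open>D\<close> is already real-linear, so homogeneity over the complex numbers is all
  that has to be added.\<close>

definition complex_differentiable_at :: "(complex2 \<Rightarrow> complex) \<Rightarrow> complex2 \<Rightarrow> bool" where
  "complex_differentiable_at f z \<longleftrightarrow>
     (\<exists>D. (f has_derivative D) (at z) \<and> (\<forall>c v. D (c * fst v, c * snd v) = c * D v))"

text \<open>A function on \<open>\<Omega>\<close> is represented by a total function that is 0 off \<open>\<Omega>\<close>. So equality of
  elements of the spaces below is equality of functions on \<open>\<Omega>\<close>, and the \<open>THE\<close> in
  \<open>bergman_projection\<close> is well defined for open \<open>\<Omega>\<close>.\<close>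

definition holomorphic_functions :: "complex2 set \<Rightarrow> (complex2 \<Rightarrow> complex) set" where
  "holomorphic_functions \<Omega> =
     {f. (\<forall>z\<in>\<Omega>. complex_differentiable_at f z) \<and> (\<forall>z. z \<notin> \<Omega> \<longrightarrow> f z = 0)}"

definition Lp_space :: "real \<Rightarrow> complex2 set \<Rightarrow> (complex2 \<Rightarrow> complex) set" where
  "Lp_space p \<Omega> = {f. f \<in> borel_measurable (lebesgue_on \<Omega>) \<and>
                       integrable (lebesgue_on \<Omega>) (\<lambda>z. norm (f z) powr p)}"

definition Lp_norm :: "real \<Rightarrow> complex2 set \<Rightarrow> (complex2 \<Rightarrow> complex) \<Rightarrow> real" where
  "Lp_norm p \<Omega> f = (LINT z|lebesgue_on \<Omega>. norm (f z) powr p) powr (1 / p)"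

definition Linfty_space :: "complex2 set \<Rightarrow> (complex2 \<Rightarrow> complex) set" where
  "Linfty_space \<Omega> = {f. f \<in> borel_measurable (lebesgue_on \<Omega>) \<and>
                         esssup (lebesgue_on \<Omega>) (\<lambda>z. ereal (norm (f z))) < \<infinity>}"

definition Linfty_norm :: "complex2 set \<Rightarrow> (complex2 \<Rightarrow> complex) \<Rightarrow> real" where
  "Linfty_norm \<Omega> f = real_of_ereal (esssup (lebesgue_on \<Omega>) (\<lambda>z. ereal (norm (f z))))"

definition A_space :: "real \<Rightarrow> complex2 set \<Rightarrow> (complex2 \<Rightarrow> complex) set" where
  "A_space p \<Omega> = Lp_space p \<Omega> \<inter> holomorphic_functions \<Omega>"

definition H_infty :: "complex2 set \<Rightarrow> (complex2 \<Rightarrow> complex) set" where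
  "H_infty \<Omega> = Linfty_space \<Omega> \<inter> holomorphic_functions \<Omega>"

definition L2_inner ::
    "complex2 set \<Rightarrow> (complex2 \<Rightarrow> complex) \<Rightarrow> (complex2 \<Rightarrow> complex) \<Rightarrow> complex" where
  "L2_inner \<Omega> f g = (LINT z|lebesgue_on \<Omega>. f z * cnj (g z))"

definition bergman_projection ::
    "complex2 set \<Rightarrow> (complex2 \<Rightarrow> complex) \<Rightarrow> (complex2 \<Rightarrow> complex)" where
  "bergman_projection \<Omega> f =
     (THE h. h \<in> A_space 2 \<Omega> \<and> (\<forall>g\<in>A_space 2 \<Omega>. L2_inner \<Omega> (\<lambda>z. f z - h z) g = 0))"

definition friedrichs_operator ::
    "complex2 set \<Rightarrow> (complex2 \<Rightarrow> complex) \<Rightarrow> (complex2 \<Rightarrow> complex)" where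
  "friedrichs_operator \<Omega> g = bergman_projection \<Omega> (\<lambda>z. cnj (g z))"

definition bounded_operator ::
    "'f set \<Rightarrow> ('f \<Rightarrow> real) \<Rightarrow> 'g set \<Rightarrow> ('g \<Rightarrow> real) \<Rightarrow> ('f \<Rightarrow> 'g) \<Rightarrow> bool" where
  "bounded_operator X norm_X Y norm_Y T \<longleftrightarrow>
     (\<forall>x\<in>X. T x \<in> Y) \<and> (\<exists>C. \<forall>x\<in>X. norm_Y (T x) \<le> C * norm_X x)"

definition punctured_disc :: "complex set" where
  "punctured_disc = {z. 0 < norm z \<and> norm z < 1}"

definition exp_hartogs_triangle :: "complex2 set" where
  "exp_hartogs_triangle = {(z1, z2). norm z1 < exp (- 1 / norm z2) \<and> z2 \<in> punctured_disc}"

end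

theory Submission
  imports Defs "HOL-Complex_Analysis.Complex_Residues"
begin

text \<open>
  Write a point of the domain as \<open>(z, w)\<close>. The domain is invariant under rotations of each
  variable, so integrals of holomorphic functions over it can be averaged over the torus first. If
  \<open>G\<close> is holomorphic, averaging \<open>\<rho>(\<bar>w\<bar>) G(z, w)\<close> over rotations of \<open>z\<close> replaces \<open>G(z, w)\<close> by
  \<open>G(0, w)\<close>, and averaging over rotations of \<open>w\<close> replaces this by the zeroth Laurent coefficient of
  \<open>G(0, \<cdot>)\<close>, a number that does not depend on the radius (\<open>integral_HT_radial_mult_holomorphic\<close>).
  Consequently only the slice \<open>z = 0\<close> of a function in \<open>A\<^sup>2\<close> matters here. Let \<open>a\<^sub>k\<close> and \<open>b\<^sub>k\<close> be the Laurent
  coefficients of \<open>g(0, \<cdot>)\<close> and \<open>f(0, \<cdot>)\<close>, and let \<open>c\<^sub>k\<close> be the square of the norm of \<open>w\<^sup>k\<close>, which is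
  finite for all integers \<open>k\<close> because the fibre over \<open>w\<close> has area \<open>\<pi> exp (- 2 / \<bar>w\<bar>)\<close>. Then
  \<open>\<langle>f, w\<^sup>k\<rangle> = c\<^sub>k b\<^sub>k\<close>, and \<open>\<integral> g f = c\<^sub>0 (\<Sum>k. a\<^sub>-\<^sub>k b\<^sub>k)\<close>, by multiplying Laurent series.

  Comparing the two formulas shows that the Friedrichs operator sends \<open>g\<close> to the series
  \<open>\<Sum>k. cnj a\<^sub>k (c\<^sub>0 / c\<^sub>-\<^sub>k) w\<^sup>-\<^sup>k\<close> (\<open>friedrichs_operator_eq_series\<close>). By Cauchy-Schwarz \<open>\<bar>a\<^sub>k\<bar>\<close> is at
  most the norm of \<open>g\<close> divided by \<open>\<surd>c\<^sub>k\<close>, so the question is how fast \<open>\<surd>c\<^sub>k c\<^sub>-\<^sub>k\<close> grows. For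
  \<open>n \<ge> 0\<close> the number \<open>c\<^sub>-\<^sub>n\<close> is at least \<open>(n!)\<^sup>2\<close> up to a geometric factor, whereas \<open>c\<^sub>n\<close> decays at
  most geometrically. The coefficient of \<open>w\<^sup>-\<^sup>n\<close> is therefore \<open>O(\<epsilon>\<^sup>n / n!)\<close> for every \<open>\<epsilon> > 0\<close>, and the series is
  bounded pointwise by \<open>C exp (\<epsilon> / \<bar>w\<bar>)\<close> times the norm of \<open>g\<close> (\<open>friedrichs_series_bound\<close>). With
  \<open>\<epsilon> = 2 / p\<close> the \<open>p\<close>-th power of this bound is integrable, since its growth cancels against the area of the
  fibres (\<open>friedrichs_series_Lp\<close>). For \<open>p = \<infinity>\<close> small fibres do not help: the function \<open>w\<close> is
  sent to a positive multiple of the unbounded function \<open>1 / w\<close>.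
\<close>

section \<open>Rotation invariance of Lebesgue measure\<close>

lemma measurable_Complex [measurable]:
  "(\<lambda>(x, y). Complex x y) \<in> borel_measurable (lborel \<Otimes>\<^sub>M lborel)"
proof -
  have "continuous_on UNIV (\<lambda>(x, y). Complex x y)"
    by (auto simp: case_prod_unfold Complex_eq intro!: continuous_intros)
  then show ?thesis
    by (simp add: lborel_prod borel_measurable_continuous_onI)
qed

lemma lborel_complex_eq_distr:
  "(lborel :: complex measure) = distr (lborel \<Otimes>\<^sub>M lborel) borel (\<lambda>(x, y). Complex x y)"
proof (rule lborel_eqI)
  fix l u :: complex assume le: "\<And>b. b \<in> Basis \<Longrightarrow> l \<bullet> b \<le> u \<bullet> b"
  have "(\<lambda>(x, y). Complex x y) -` box l u = {Re l<..<Re u} \<times> {Im l<..<Im u}"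
    by (auto simp: box_def Basis_complex_def)
  then show "emeasure (distr (lborel \<Otimes>\<^sub>M lborel) borel (\<lambda>(x, y). Complex x y)) (box l u)
      = (\<Prod>b\<in>Basis. (u - l) \<bullet> b)"
    using le[of 1] le[of \<i>]
    by (simp add: emeasure_distr space_pair_measure lborel.emeasure_pair_measure_Times
        Basis_complex_def ennreal_mult'')
qed simp

text \<open>On each horizontal line the shear is a translation.\<close>

lemma distr_shear_fst:
  fixes a :: real
  shows "distr (lborel \<Otimes>\<^sub>M lborel) (lborel \<Otimes>\<^sub>M lborel) (\<lambda>(x, y). (x + a * y, y)) = lborel \<Otimes>\<^sub>M lborel"
proof (rule measure_eqI)
  fix A :: "(real \<times> real) set"
  assume "A \<in> sets (distr (lborel \<Otimes>\<^sub>M lborel) (lborel \<Otimes>\<^sub>M lborel) (\<lambda>(x, y). (x + a * y, y)))"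
  then have A [measurable]: "A \<in> sets (lborel \<Otimes>\<^sub>M lborel)" by simp
  let ?f = "\<lambda>(x, y). (x + a * y, y)"
  have f [measurable]: "?f \<in> lborel \<Otimes>\<^sub>M lborel \<rightarrow>\<^sub>M lborel \<Otimes>\<^sub>M lborel"
    by measurable
  have slice: "emeasure lborel ((\<lambda>x. (x, y)) -` (?f -` A)) = emeasure lborel ((\<lambda>x. (x, y)) -` A)" for y
  proof -
    have m: "(\<lambda>x. (x, y)) -` A \<in> sets borel"
      using sets_Pair2[OF A, of y] by simp
    have "emeasure lborel ((\<lambda>x. (x, y)) -` A)
      = emeasure (distr lborel borel ((+) (a * y))) ((\<lambda>x. (x, y)) -` A)"
      by (simp add: lborel_distr_plus)
    also have "\<dots> = emeasure lborel ((+) (a * y) -` ((\<lambda>x. (x, y)) -` A))"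
      using m by (subst emeasure_distr) auto
    finally show ?thesis by (simp add: vimage_def add.commute)
  qed
  have fA: "?f -` A \<in> sets (lborel \<Otimes>\<^sub>M lborel)"
    using measurable_sets[OF f A] by (simp add: space_pair_measure)
  then show "emeasure (distr (lborel \<Otimes>\<^sub>M lborel) (lborel \<Otimes>\<^sub>M lborel) ?f) A
    = emeasure (lborel \<Otimes>\<^sub>M lborel) A"
    by (simp add: emeasure_distr[OF f A] space_pair_measure
      lborel_pair.emeasure_pair_measure_alt2[OF A] lborel_pair.emeasure_pair_measure_alt2[OF fA] slice)
qed simp

lemma distr_shear_snd:
  fixes a :: real
  shows "distr (lborel \<Otimes>\<^sub>M lborel) (lborel \<Otimes>\<^sub>M lborel) (\<lambda>(x, y). (x, y + a * x)) = lborel \<Otimes>\<^sub>M lborel"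
proof (rule measure_eqI)
  fix A :: "(real \<times> real) set"
  assume "A \<in> sets (distr (lborel \<Otimes>\<^sub>M lborel) (lborel \<Otimes>\<^sub>M lborel) (\<lambda>(x, y). (x, y + a * x)))"
  then have A [measurable]: "A \<in> sets (lborel \<Otimes>\<^sub>M lborel)" by simp
  let ?f = "\<lambda>(x, y). (x, y + a * x)"
  have f [measurable]: "?f \<in> lborel \<Otimes>\<^sub>M lborel \<rightarrow>\<^sub>M lborel \<Otimes>\<^sub>M lborel"
    by measurable
  have slice: "emeasure lborel (Pair x -` (?f -` A)) = emeasure lborel (Pair x -` A)" for x
  proof -
    have m: "Pair x -` A \<in> sets borel"
      using sets_Pair1[OF A, of x] by simp
    have "emeasure lborel (Pair x -` A) = emeasure (distr lborel borel ((+) (a * x))) (Pair x -` A)"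
      by (simp add: lborel_distr_plus)
    also have "\<dots> = emeasure lborel ((+) (a * x) -` (Pair x -` A))"
      using m by (subst emeasure_distr) auto
    finally show ?thesis by (simp add: vimage_def add.commute)
  qed
  have fA: "?f -` A \<in> sets (lborel \<Otimes>\<^sub>M lborel)"
    using measurable_sets[OF f A] by (simp add: space_pair_measure)
  then show "emeasure (distr (lborel \<Otimes>\<^sub>M lborel) (lborel \<Otimes>\<^sub>M lborel) ?f) A
    = emeasure (lborel \<Otimes>\<^sub>M lborel) A"
    by (simp add: emeasure_distr[OF f A] space_pair_measure lborel.emeasure_pair_measure_alt[OF A]
      lborel.emeasure_pair_measure_alt[OF fA] slice)
qed simp

text \<open>A rotation of the plane that is not real multiplication is a product of three shears,
  \<open>(1 a; 0 1) (1 0; s 1) (1 a; 0 1)\<close> with \<open>s\<close> the sine of the angle and \<open>a = (cos - 1) / s\<close>. The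
  rotation by \<open>-1\<close> is the square of the rotation by \<open>\<i>\<close>.\<close>

lemma lborel_distr_rotation:
  fixes u :: complex
  assumes u: "norm u = 1"
  shows "distr lborel borel ((*) u) = lborel"
proof -
  let ?P = "lborel \<Otimes>\<^sub>M lborel :: (real \<times> real) measure"
  let ?C = "\<lambda>(x, y). Complex x y"
  have nonreal: "distr lborel borel ((*) u) = lborel" if u: "norm u = 1" and nz: "Im u \<noteq> 0"
    for u :: complex
  proof -
    define c s where "c = Re u" and "s = Im u"
    have cs: "c\<^sup>2 + s\<^sup>2 = 1" using u by (simp add: c_def s_def norm_complex_def)
    \<comment> \<open>This is \<open>- tan (\<phi> / 2)\<close> for the rotation by the angle \<open>\<phi>\<close>.\<close>
    define a where "a = (c - 1) / s"
    have s: "s \<noteq> 0" using nz by (simp add: s_def)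
    have as: "a * s = c - 1" using s by (simp add: a_def)
    have ac: "a * (1 + c) = - s"
      using s cs by (simp add: a_def field_simps power2_eq_square)
    let ?S = "\<lambda>(x, y). (x + a * y, y)" and ?T = "\<lambda>(x, y). (x, y + s * x)"
    have S: "?S \<in> ?P \<rightarrow>\<^sub>M ?P" and T: "?T \<in> ?P \<rightarrow>\<^sub>M ?P"
      by measurable
    note TS = measurable_comp[OF S T] and STS = measurable_comp[OF measurable_comp[OF S T] S]
    have inv: "distr ?P ?P (?S \<circ> (?T \<circ> ?S)) = ?P"
      unfolding distr_distr[OF S TS, symmetric] distr_distr[OF T S, symmetric]
        distr_shear_fst distr_shear_snd ..
    have comp: "((*) u) \<circ> ?C = ?C \<circ> (?S \<circ> (?T \<circ> ?S))"
    proof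
      fix z :: "real \<times> real"
      obtain x y where z: "z = (x, y)" by (cases z)
      have "y + s * (x + a * y) = s * x + (1 + a * s) * y" by (simp add: algebra_simps)
      then have y: "y + s * (x + a * y) = s * x + c * y" by (simp add: as)
      have "(x + a * y) + a * (s * x + c * y) = (1 + a * s) * x + a * (1 + c) * y"
        by (simp add: algebra_simps)
      then have x: "(x + a * y) + a * (s * x + c * y) = c * x - s * y"
        by (simp add: as ac)
      show "((*) u \<circ> ?C) z = (?C \<circ> (?S \<circ> (?T \<circ> ?S))) z"
        unfolding z o_apply prod.case y x by (simp add: complex_eq_iff c_def s_def)
    qed
    have "distr lborel borel ((*) u) = distr (distr ?P borel ?C) borel ((*) u)"
      by (simp flip: lborel_complex_eq_distr)
    also have "\<dots> = distr ?P borel (((*) u) \<circ> ?C)"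
      by (subst distr_distr[OF _ measurable_Complex]) auto
    also have "\<dots> = distr (distr ?P ?P (?S \<circ> (?T \<circ> ?S))) borel ?C"
      unfolding comp by (rule distr_distr[OF measurable_Complex STS, symmetric])
    also have "\<dots> = lborel"
      unfolding inv by (simp flip: lborel_complex_eq_distr)
    finally show ?thesis .
  qed
  show ?thesis
  proof (cases "Im u = 0")
    case True
    with u have "\<bar>Re u\<bar> = 1" by (simp add: norm_complex_def)
    with True consider "u = 1" | "u = - 1"
      by (auto simp: complex_eq_iff abs_if split: if_splits)
    then show ?thesis
    proof cases
      case 1
      have "(*) (1 :: complex) = (\<lambda>z. z)" by auto
      with 1 show ?thesis by (simp add: distr_id2)
    next
      case 2
      have i: "distr lborel borel ((*) \<i>) = lborel" by (rule nonreal) auto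
      have eq: "(*) (- 1) = (*) \<i> \<circ> (*) \<i>" by (auto simp flip: mult.assoc)
      have "distr lborel borel ((*) (- 1)) = distr (distr lborel borel ((*) \<i>)) borel ((*) \<i>)"
        unfolding eq by (rule distr_distr[symmetric]) auto
      then show ?thesis unfolding 2 by (simp only: i)
    qed
  qed (use nonreal u in blast)
qed

lemma lborel_distr_bi_rotation:
  fixes u v :: complex
  assumes "norm u = 1" "norm v = 1"
  shows "distr lborel borel (\<lambda>(z, w). (u * z, v * w)) = lborel"
proof -
  have "lborel \<Otimes>\<^sub>M lborel = distr lborel borel ((*) u) \<Otimes>\<^sub>M distr lborel borel ((*) v)"
    by (simp add: assms lborel_distr_rotation)
  also have "\<dots> = distr (lborel \<Otimes>\<^sub>M lborel) (borel \<Otimes>\<^sub>M borel) (\<lambda>(z, w). (u * z, v * w))"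
    by (rule pair_measure_distr)
      (auto simp: assms lborel_distr_rotation lborel.sigma_finite_measure_axioms)
  finally show ?thesis by (simp add: lborel_prod borel_prod)
qed

text \<open>Fubini's theorem on \<open>[0, 1] \<times> 'a\<close>: each \<open>T s\<close> preserves the integral of \<open>\<Phi>\<close>, hence so does the
  average over \<open>s\<close>.\<close>

lemma integral_average_measure_preserving:
  fixes \<Phi> :: "'a::euclidean_space \<Rightarrow> complex" and T :: "real \<Rightarrow> 'a \<Rightarrow> 'a"
  assumes T: "(\<lambda>(s, z). T s z) \<in> borel_measurable borel"
    and inv: "\<And>s. distr lborel borel (T s) = lborel"
    and \<Phi>: "integrable lborel \<Phi>"
  shows "integrable lborel (\<lambda>z. LINT s:{0..1}|lborel. \<Phi> (T s z))"
    and "(LINT z|lborel. (LINT s:{0..1}|lborel. \<Phi> (T s z))) = (LINT z|lborel. \<Phi> z)"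
proof -
  have [measurable]: "(\<lambda>(s, z). T s z) \<in> lborel \<Otimes>\<^sub>M lborel \<rightarrow>\<^sub>M borel"
    using T by (simp add: lborel_prod)
  have [measurable]: "\<Phi> \<in> borel_measurable borel"
    using \<Phi> by simp
  have Ts [measurable]: "T s \<in> borel_measurable borel" for s
  proof -
    have "(\<lambda>z. case (s, z) of (s, z) \<Rightarrow> T s z) \<in> borel_measurable lborel" by measurable
    then show ?thesis by simp
  qed
  have int: "integrable lborel (\<lambda>z. \<Phi> (T s z))" for s
    using \<Phi> by (subst (asm) inv[of s, symmetric], subst (asm) integrable_distr_eq) auto
  have nrm: "(LINT z|lborel. norm (\<Phi> (T s z))) = (LINT z|lborel. norm (\<Phi> z))" for s
    by (subst (2) inv[of s, symmetric], subst integral_distr) auto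
  have eq: "(LINT z|lborel. \<Phi> (T s z)) = (LINT z|lborel. \<Phi> z)" for s
    by (subst (2) inv[of s, symmetric], subst integral_distr) auto
  let ?f = "\<lambda>(s::real, z). indicator {0..1} s *\<^sub>R \<Phi> (T s z)"
  have I: "integrable (lborel \<Otimes>\<^sub>M lborel) ?f"
  proof (rule lborel_pair.Fubini_integrable)
    show "?f \<in> borel_measurable (lborel \<Otimes>\<^sub>M lborel)"
      by measurable
    have "integrable lborel (\<lambda>s::real. indicator {0..1} s *\<^sub>R (LINT z|lborel. norm (\<Phi> z)))"
      by (intro integrable_real_indicator integrable_scaleR_left) auto
    then show "integrable lborel (\<lambda>s. LINT z|lborel. norm (?f (s, z)))"
      by (simp add: nrm)
    show "AE s in lborel. integrable lborel (\<lambda>z. ?f (s, z))"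
      using int by simp
  qed
  show "integrable lborel (\<lambda>z. LINT s:{0..1}|lborel. \<Phi> (T s z))"
    using lborel_pair.integrable_snd[OF I] by (simp add: set_lebesgue_integral_def)
  have "(LINT z|lborel. (LINT s:{0..1}|lborel. \<Phi> (T s z)))
      = (LINT s|lborel. LINT z|lborel. indicator {0..1} s *\<^sub>R \<Phi> (T s z))"
    unfolding set_lebesgue_integral_def
    by (subst lborel_pair.integral_snd[OF I], subst lborel_pair.integral_fst[OF I]) simp
  also have "\<dots> = (LINT s|lborel. indicator {0..1::real} s *\<^sub>R (LINT z|lborel. \<Phi> z))"
    by (simp add: eq)
  also have "\<dots> = (LINT z|lborel. \<Phi> z)"
    by simp
  finally show "(LINT z|lborel. (LINT s:{0..1}|lborel. \<Phi> (T s z))) = (LINT z|lborel. \<Phi> z)" .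
qed

section \<open>Laurent series on a punctured disc\<close>

text \<open>Residues are used because they are defined at essential singularities too, and because the
  integral over every circle around the puncture computes the same residue: no radius has to be
  chosen.\<close>

definition laurent_coeff :: "(complex \<Rightarrow> complex) \<Rightarrow> int \<Rightarrow> complex" where
  "laurent_coeff f k = residue (\<lambda>w. f w * w powi (- k - 1)) 0"

lemma powi_minus_Suc: "x powi (- int (Suc n)) = inverse x ^ Suc n"
  for x :: "'a::field"
  unfolding power_int_minus power_int_of_nat by (rule power_inverse[symmetric])

lemma holomorphic_on_powi_punctured:
  "(\<lambda>w::complex. w powi k) holomorphic_on (A - {0})"
  by (cases "k \<ge> 0") (auto simp: power_int_def intro!: holomorphic_intros)

lemma has_contour_integral_circle_laurent_coeff:
  assumes f: "f holomorphic_on ball 0 R - {0}" and r: "0 < r" "r < R"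
  shows "((\<lambda>w. f w * w powi (- k - 1)) has_contour_integral 2 * pi * \<i> * laurent_coeff f k)
           (circlepath 0 r)"
  unfolding laurent_coeff_def
proof (rule base_residue)
  show "(\<lambda>w. f w * w powi (- k - 1)) holomorphic_on ball 0 R - {0}"
    by (intro holomorphic_intros f holomorphic_on_powi_punctured)
qed (use r in auto)

lemma laurent_coeff_0: "laurent_coeff f 0 = residue (\<lambda>w. f w / w) 0"
  by (simp add: laurent_coeff_def power_int_minus divide_inverse)

lemma laurent_coeff_holomorphic:
  assumes "f holomorphic_on ball 0 R" "0 < R"
  shows "laurent_coeff f 0 = f 0"
  using residue_simple[of "ball 0 R" 0 f] assms by (simp add: laurent_coeff_0)

lemma laurent_coeff_mult_powi: 
  assumes f: "f holomorphic_on ball 0 R - {0}" and R: "0 < R"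
  shows "laurent_coeff (\<lambda>w. f w * w powi m) k = laurent_coeff f (k - m)"
proof -
  have "eventually (\<lambda>w. f w * w powi m * w powi (- k - 1)
    = f w * w powi (- (k - m) - 1)) (at (0::complex))"
  proof (rule eventually_mono[OF eventually_neq_at_within])
    fix w :: complex assume "w \<noteq> 0"
    then show "f w * w powi m * w powi (- k - 1) = f w * w powi (- (k - m) - 1)"
      by (simp add: mult.assoc power_int_add[symmetric] algebra_simps)
  qed
  then show ?thesis
    unfolding laurent_coeff_def by (rule residue_cong) simp
qed

text \<open>The mean of \<open>f\<close> over a circle is the contour integral of \<open>f w / w\<close>, up to a constant. The starting
  point of the circle may be any point \<open>z\<close>, as this only shifts the parametrisation.\<close>

lemma has_integral_circle_mean:
  assumes f: "f holomorphic_on ball 0 R - {0}" and z: "0 < norm z" "norm z < R"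
  shows "((\<lambda>t. f (exp (2 * of_real pi * \<i> * of_real t) * z)) has_integral laurent_coeff f 0) {0..1}"
proof -
  define r where "r = norm z"
  obtain a where a: "a \<in> {0..1}" and za: "z = r * exp (2 * of_real pi * \<i> * of_real a)"
  proof -
    define a where "a = Arg2pi z / (2 * pi)"
    have "a \<in> {0..1}"
      using Arg2pi_ge_0[of z] Arg2pi_lt_2pi[of z] by (auto simp: a_def field_simps)
    moreover have "z = r * exp (2 * of_real pi * \<i> * of_real a)"
      using Arg2pi_eq[of z] by (simp add: a_def r_def mult.commute)
    ultimately show ?thesis using that by blast
  qed
  have r: "0 < r" "r < R" using z by (auto simp: r_def)
  \<comment> \<open>The circle starting at \<open>z\<close> is the standard one, shifted by the argument of \<open>z\<close>.\<close>
  have eq: "shiftpath a (circlepath 0 r) t = z * exp (2 * of_real pi * \<i> * of_real t)" for t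
  proof -
    let ?e = "\<lambda>x. exp (2 * of_real pi * \<i> * x) :: complex"
    have add: "?e (x + y) = ?e x * ?e y" for x y
      by (simp only: distrib_left exp_add)
    have "?e (x - 1) = ?e x" for x
      by (simp only: right_diff_distrib exp_diff) (simp add: exp_two_pi_i)
    from this[of "of_real a + of_real t"] show ?thesis
      by (auto simp: shiftpath_def circlepath za add)
  qed
  have "((\<lambda>w. f w * w powi (- 0 - 1)) has_contour_integral 2 * pi * \<i> * laurent_coeff f 0)
           (shiftpath a (circlepath 0 r))"
    using has_contour_integral_circle_laurent_coeff[OF f r, of 0] a
    by (intro has_contour_integral_shiftpath) auto
  then have "((\<lambda>w. f w / w) has_contour_integral 2 * pi * \<i> * laurent_coeff f 0)
           (\<lambda>t. z * exp (2 * of_real pi * \<i> * of_real t))"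
    by (simp add: eq[abs_def] power_int_minus divide_inverse)
  moreover have "vector_derivative (\<lambda>t. z * exp (2 * of_real pi * \<i> * of_real t)) (at t within {0..1})
      = z * (2 * of_real pi * \<i>) * exp (2 * of_real pi * \<i> * of_real t)" if "t \<in> {0..1}" for t
  proof (rule vector_derivative_within_closed_interval)
    show "((\<lambda>t. z * exp (2 * of_real pi * \<i> * of_real t)) has_vector_derivative z * (2 * of_real pi
      * \<i>) * exp (2 * of_real pi * \<i> * of_real t)) (at t within {0..1})"
      by (rule has_vector_derivative_real_field) (auto intro!: derivative_eq_intros)
  qed (use that in auto)
  ultimately have "((\<lambda>t. f (z * exp (2 * of_real pi * \<i> * of_real t)) / (z * exp (2 * of_real pi * \<i>
    * of_real t))
       * (z * (2 * of_real pi * \<i>) * exp (2 * of_real pi * \<i> * of_real t)))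
         has_integral 2 * pi * \<i> * laurent_coeff f 0) {0..1}"
    unfolding has_contour_integral_def by (elim has_integral_eq[rotated]) (simp only:)
  then have "((\<lambda>t. (2 * of_real pi * \<i>) * f (z * exp (2 * of_real pi * \<i> * of_real t)))
    has_integral (2 * pi * \<i>) * laurent_coeff f 0) {0..1}"
    using z by (simp add: field_simps)
  from has_integral_mult_right[OF this, of "1 / (2 * of_real pi * \<i>)"]
  have "((\<lambda>t. f (z * exp (2 * of_real pi * \<i> * of_real t))) has_integral laurent_coeff f 0) {0..1}"
    by simp
  then show ?thesis by (simp add: mult.commute)
qed

lemma set_integral_circle_mean:
  assumes f: "f holomorphic_on ball 0 R - {0}" and z: "0 < norm z" "norm z < R"
  shows "(LINT t:{0..1}|lborel. f (exp (2 * of_real pi * \<i> * of_real t) * z)) = laurent_coeff f 0"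
proof -
  have "continuous_on {0..1} (f \<circ> (\<lambda>t::real. exp (2 * of_real pi * \<i> * of_real t) * z))"
  proof (rule continuous_on_compose)
    show "continuous_on ((\<lambda>t::real. exp (2 * of_real pi * \<i> * of_real t) * z) ` {0..1}) f"
      by (rule continuous_on_subset[OF holomorphic_on_imp_continuous_on[OF f]])
        (use z in \<open>auto simp: norm_mult\<close>)
  qed (intro continuous_intros)
  then have "set_integrable lborel {0..1} (\<lambda>t. f (exp (2 * of_real pi * \<i> * of_real t) * z))"
    by (intro borel_integrable_atLeastAtMost') (simp add: o_def)
  from set_borel_integral_eq_integral(2)[OF this] show ?thesis
    using has_integral_circle_mean[OF f z] by (simp add: integral_unique)
qed

text \<open>Termwise integration on one circle. This serves twice: when \<open>P\<close> is the Cauchy kernel, expanded as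
  a geometric series, it gives the Laurent expansion of \<open>f\<close>; when \<open>P\<close> is half of the Laurent
  series of another function, it gives the Cauchy product.\<close>

lemma laurent_coeff_termwise:
  assumes f: "f holomorphic_on ball 0 R - {0}" and r: "0 < r" "r < R"
    and P: "\<And>w. norm w = r \<Longrightarrow> (\<lambda>n. b n * w powi e n) sums P w"
    and b: "summable (\<lambda>n. norm (b n) * r powi e n)"
  shows "(\<lambda>w. f w * P w / w) contour_integrable_on circlepath 0 r"
    and "(\<lambda>n. b n * laurent_coeff f (- e n)) sums
           (contour_integral (circlepath 0 r) (\<lambda>w. f w * P w / w) / (2 * pi * \<i>))"
proof -
  let ?t = "\<lambda>n w. b n * (f w * w powi (- (- e n) - 1))"
  have "continuous_on (sphere 0 r) f"
    using r by (intro continuous_on_subset[OF holomorphic_on_imp_continuous_on[OF f]]) auto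
  then have "bounded (f ` sphere 0 r)"
    by (intro compact_imp_bounded compact_continuous_image) auto
  then obtain B where B: "\<And>w. norm w = r \<Longrightarrow> norm (f w) \<le> B"
    unfolding bounded_iff by (metis imageI dist_0_norm mem_sphere)
  have sums: "(\<lambda>n. ?t n w) sums (f w * P w / w)" if w: "w \<in> sphere 0 r" for w
  proof -
    have "w \<noteq> 0" using w r by auto
    then have "?t n w = (f w / w) * (b n * w powi e n)" for n
      by (simp add: power_int_diff)
    then show ?thesis
      using sums_mult[OF P, of w "f w / w"] w by (simp add: mult.commute mult.left_commute)
  qed
  have "uniform_limit (sphere 0 r) (\<lambda>n w. \<Sum>i<n. ?t i w) (\<lambda>w. suminf (\<lambda>i. ?t i w)) sequentially"
  proof (rule Weierstrass_m_test)
    show "summable (\<lambda>n. (B / r) * (norm (b n) * r powi e n))"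
      by (intro summable_mult b)
    fix n and w :: complex assume w: "w \<in> sphere 0 r"
    have "norm (?t n w) = norm (b n) * (norm (f w) * (r powi e n / r))"
      using w r by (simp add: norm_mult norm_power_int power_int_diff)
    also have "\<dots> \<le> norm (b n) * (B * (r powi e n / r))"
      using B[of w] w r by (intro mult_left_mono mult_right_mono) auto
    finally show "norm (?t n w) \<le> (B / r) * (norm (b n) * r powi e n)"
      by (simp add: mult.commute mult.left_commute)
  qed
  also have "?this \<longleftrightarrow> uniform_limit (sphere 0 r) (\<lambda>n w. \<Sum>i<n. ?t i w) (\<lambda>w. f w * P w / w) sequentially"
    by (rule uniform_limit_cong') (use sums in \<open>auto simp: sums_iff\<close>)
  finally have ul: "uniform_limit (sphere 0 r) (\<lambda>n w. \<Sum>i<n. ?t i w) (\<lambda>w. f w * P w / w) sequentially" .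
  have int: "((\<lambda>w. \<Sum>i<n. ?t i w)
    has_contour_integral (\<Sum>i<n. b i * (2 * pi * \<i> * laurent_coeff f (- e i)))) (circlepath 0 r)" for n
    by (intro has_contour_integral_sum has_contour_integral_lmul
        has_contour_integral_circle_laurent_coeff[OF f r]) auto
  have ev: "\<forall>\<^sub>F n in sequentially. (\<lambda>w. \<Sum>i<n. ?t i w) contour_integrable_on circlepath 0 r"
    using int unfolding contour_integrable_on_def by (intro always_eventually allI exI)
  show "(\<lambda>w. f w * P w / w) contour_integrable_on circlepath 0 r"
    by (rule contour_integral_uniform_limit_circlepath(1)[OF ev ul]) (use r in auto)
  have "(\<lambda>n. contour_integral (circlepath 0 r) (\<lambda>w. \<Sum>i<n. ?t i w))
    \<longlonglongrightarrow> contour_integral (circlepath 0 r) (\<lambda>w. f w * P w / w)"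
    by (rule contour_integral_uniform_limit_circlepath(2)[OF ev ul]) (use r in auto)
  then have "(\<lambda>i. b i * (2 * pi * \<i> * laurent_coeff f (- e i)))
    sums contour_integral (circlepath 0 r) (\<lambda>w. f w * P w / w)"
    unfolding contour_integral_unique[OF int] sums_def .
  from sums_mult[OF this, of "1 / (2 * pi * \<i>)"]
  have "(\<lambda>n. 1 / (2 * pi * \<i>) * (b n * (2 * pi * \<i> * laurent_coeff f (- e n)))) sums
           (1 / (2 * pi * \<i>) * contour_integral (circlepath 0 r) (\<lambda>w. f w * P w / w))" .
  moreover have "1 / (2 * pi * \<i>) * (b n * (2 * pi * \<i> * laurent_coeff f (- e n)))
    = b n * laurent_coeff f (- e n)" for n
    using pi_neq_zero by (simp add: field_simps del: pi_neq_zero)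
  ultimately show "(\<lambda>n. b n * laurent_coeff f (- e n)) sums
           (contour_integral (circlepath 0 r) (\<lambda>w. f w * P w / w) / (2 * pi * \<i>))"
    by (simp only: mult_1_left times_divide_eq_left)
qed

text \<open>The difference quotient \<open>(f w - f z) / (w - z)\<close> extends holomorphically across \<open>z\<close>, so its integrals
  over the two circles agree; it remains to integrate \<open>1 / (w - z)\<close>, which sees \<open>z\<close> from the outer circle
  only.\<close>

lemma cauchy_annulus:
  assumes f: "f holomorphic_on ball 0 R - {0}" and r: "0 < r1" "r1 < norm z" "norm z < r2" "r2 < R"
  shows "contour_integral (circlepath 0 r2) (\<lambda>w. f w / (w - z))
       - contour_integral (circlepath 0 r1) (\<lambda>w. f w / (w - z)) = 2 * pi * \<i> * f z"
proof -
  let ?S = "ball 0 R - {0::complex}"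
  have z: "z \<in> ?S" using r by auto
  define q where "q = (\<lambda>w. if w = z then deriv f z else (f w - f z) / (w - z))"
  have q: "q holomorphic_on ?S"
    unfolding q_def by (rule pole_lemma_open[OF f]) auto
  have f_cont: "continuous_on ?S f"
    using f by (rule holomorphic_on_imp_continuous_on)
  have diff: "contour_integral (circlepath 0 \<rho>) (\<lambda>w. f w / (w - z))
      = 2 * pi * \<i> * residue q 0 + f z * contour_integral (circlepath 0 \<rho>) (\<lambda>w. 1 / (w - z))"
    if \<rho>: "0 < \<rho>" "\<rho> < R" "\<rho> \<noteq> norm z" for \<rho>
  proof -
    have int: "(\<lambda>w. 1 / (w - z)) contour_integrable_on circlepath 0 \<rho>"
      using \<rho> by (intro contour_integrable_continuous_circlepath continuous_intros) auto
    have "(q has_contour_integral 2 * pi * \<i> * residue q 0) (circlepath 0 \<rho>)"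
      by (rule base_residue[of "ball 0 R"]) (use \<rho> q in auto)
    then have "((\<lambda>w. q w + f z * (1 / (w - z))) has_contour_integral
       2 * pi * \<i> * residue q 0 + f z * contour_integral (circlepath 0 \<rho>) (\<lambda>w. 1 / (w - z)))
         (circlepath 0 \<rho>)"
      by (intro has_contour_integral_add has_contour_integral_lmul has_contour_integral_integral int)
    then have "((\<lambda>w. f w / (w - z)) has_contour_integral
       2 * pi * \<i> * residue q 0 + f z * contour_integral (circlepath 0 \<rho>) (\<lambda>w. 1 / (w - z)))
         (circlepath 0 \<rho>)"
      by (rule has_contour_integral_eq)
        (use \<rho> in \<open>auto simp: q_def path_image_circlepath diff_divide_distrib\<close>)
    then show ?thesis by (rule contour_integral_unique)
  qed
  have outer: "contour_integral (circlepath 0 r2) (\<lambda>w. 1 / (w - z)) = 2 * pi * \<i>"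
    using Cauchy_integral_circlepath_simple[of "\<lambda>_. 1" 0 r2 z] r
    by (intro contour_integral_unique) auto
  have inner: "contour_integral (circlepath 0 r1) (\<lambda>w. 1 / (w - z)) = 0"
  proof (rule contour_integral_unique, rule Cauchy_theorem_disc_simple)
    show "(\<lambda>w. 1 / (w - z)) holomorphic_on ball 0 (norm z)"
      by (intro holomorphic_intros) auto
  qed (use r in auto)
  show ?thesis
    using r by (subst (1 2) diff) (auto simp: outer inner)
qed

lemma laurent_expansion:
  assumes f: "f holomorphic_on ball 0 R - {0}" and z: "z \<noteq> 0" "norm z < R"
  obtains P Q where "(\<lambda>n. laurent_coeff f (int n) * z powi int n) sums P"
    and "(\<lambda>n. laurent_coeff f (- int (Suc n)) * z powi (- int (Suc n))) sums Q"
    and "f z = P + Q"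
proof -
  define r1 where "r1 = norm z / 2"
  define r2 where "r2 = (norm z + R) / 2"
  have r: "0 < r1" "r1 < norm z" "norm z < r2" "r2 < R"
    using z by (auto simp: r1_def r2_def)
  let ?I = "\<lambda>r. contour_integral (circlepath 0 r) (\<lambda>w. f w / (w - z))"
  have "(\<lambda>n. z ^ n * laurent_coeff f (- (- int n))) sums
      (contour_integral (circlepath 0 r2) (\<lambda>w. f w * (w / (w - z)) / w) / (2 * pi * \<i>))"
  proof (rule laurent_coeff_termwise(2)[OF f])
    fix w :: complex assume w: "norm w = r2"
    have [simp]: "w \<noteq> 0" "w - z \<noteq> 0" using w r by auto
    have "(\<lambda>n. (z / w) ^ n) sums (1 / (1 - z / w))"
      using w r by (intro geometric_sums) (auto simp: norm_divide)
    moreover have "1 / (1 - z / w) = w / (w - z)"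
      by (simp add: divide_simps)
    ultimately show "(\<lambda>n. z ^ n * w powi (- int n)) sums (w / (w - z))"
      by (simp add: power_int_minus power_divide field_simps)
  next
    have "summable (\<lambda>n. (norm z / r2) ^ n)"
      using r by (intro summable_geometric) auto
    then show "summable (\<lambda>n. norm (z ^ n) * r2 powi (- int n))"
      by (simp add: norm_power power_int_minus power_divide field_simps)
  qed (use r in auto)
  moreover have "contour_integral (circlepath 0 r2) (\<lambda>w. f w * (w / (w - z)) / w) = ?I r2"
    using r by (intro contour_integral_cong) auto
  ultimately have 1: "(\<lambda>n. laurent_coeff f (int n) * z powi int n) sums (?I r2 / (2 * pi * \<i>))"
    by (simp add: mult.commute)
  have "(\<lambda>n. z powi (- int (Suc n)) * laurent_coeff f (- int (Suc n))) sums
      (contour_integral (circlepath 0 r1) (\<lambda>w. f w * (- w / (w - z)) / w) / (2 * pi * \<i>))"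
  proof (rule laurent_coeff_termwise(2)[OF f])
    fix w :: complex assume w: "norm w = r1"
    have [simp]: "w \<noteq> 0" "z - w \<noteq> 0" "w - z \<noteq> 0" using w r by auto
    have "(\<lambda>n. (w / z) * (w / z) ^ n) sums ((w / z) * (1 / (1 - w / z)))"
      using w r by (intro sums_mult geometric_sums) (auto simp: norm_divide divide_less_eq)
    moreover have "(w / z) * (1 / (1 - w / z)) = - w / (w - z)"
      using z by (simp add: divide_simps) (simp add: algebra_simps)
    moreover have "(w / z) * (w / z) ^ n = z powi (- int (Suc n)) * w powi int (Suc n)" for n
      unfolding powi_minus_Suc power_int_of_nat
      by (simp add: divide_inverse power_mult_distrib norm_power norm_inverse ac_simps)
    ultimately show "(\<lambda>n. z powi (- int (Suc n)) * w powi int (Suc n)) sums (- w / (w - z))"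
      by simp
  next
    have "summable (\<lambda>n. (r1 / norm z) * (r1 / norm z) ^ n)"
      using r by (intro summable_mult summable_geometric) (auto simp: divide_less_eq)
    moreover have "(r1 / norm z) * (r1 / norm z) ^ n
      = norm (z powi (- int (Suc n))) * r1 powi int (Suc n)" for n
      unfolding powi_minus_Suc power_int_of_nat
      by (simp add: divide_inverse power_mult_distrib norm_power norm_inverse norm_mult ac_simps)
    ultimately show "summable (\<lambda>n. norm (z powi (- int (Suc n))) * r1 powi int (Suc n))"
      by (simp only:)
  qed (use r in auto)
  moreover have "contour_integral (circlepath 0 r1) (\<lambda>w. f w * (- w / (w - z)) / w)
    = contour_integral (circlepath 0 r1) (\<lambda>w. - (f w / (w - z)))"
    using r by (intro contour_integral_cong) auto
  ultimately have 2: "(\<lambda>n. laurent_coeff f (- int (Suc n)) * z powi (- int (Suc n)))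
    sums (- ?I r1 / (2 * pi * \<i>))"
    by (simp add: mult.commute contour_integral_neg)
  have "f z = ?I r2 / (2 * pi * \<i>) + - ?I r1 / (2 * pi * \<i>)"
    using cauchy_annulus[OF f r] by (simp add: field_simps)
  with 1 2 show ?thesis using that by blast
qed

text \<open>Convergence on a larger circle, respectively on a smaller one, gives absolute convergence.\<close>

lemma laurent_coeff_summable:
  assumes f: "f holomorphic_on ball 0 R - {0}" and r: "0 < r" "r < R"
  shows "summable (\<lambda>n. norm (laurent_coeff f (int n)) * r powi int n)"
    and "summable (\<lambda>n. norm (laurent_coeff f (- int (Suc n))) * r powi (- int (Suc n)))"
proof -
  define s where "s = (r + R) / 2"
  have s: "r < s" "0 < s" "s < R" using r by (auto simp: s_def)
  obtain P where "(\<lambda>n. laurent_coeff f (int n) * complex_of_real s powi int n) sums P"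
    using laurent_expansion[OF f, of "of_real s"] s by auto
  then have "summable (\<lambda>n. laurent_coeff f (int n) * complex_of_real s ^ n)"
    by (simp add: sums_iff)
  then have "summable (\<lambda>n. norm (laurent_coeff f (int n) * complex_of_real r ^ n))"
    by (rule powser_insidea) (use r s in auto)
  then show "summable (\<lambda>n. norm (laurent_coeff f (int n)) * r powi int n)"
    using r by (simp add: norm_mult norm_power)
  obtain Q where "(\<lambda>n. laurent_coeff f (- int (Suc n)) * complex_of_real (r/2) powi (- int (Suc n)))
    sums Q"
    by (rule laurent_expansion[OF f, of "of_real (r/2)"]) (use r in auto)
  then have "summable (\<lambda>n. laurent_coeff f (- int (Suc n)) * complex_of_real (2/r) ^ Suc n)"
    by (simp add: sums_iff powi_minus_Suc del: of_nat_Suc power_Suc)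
  then have "summable (\<lambda>n. laurent_coeff f (- int n) * complex_of_real (2/r) ^ n)"
    by (simp only: summable_Suc_iff[of "\<lambda>n. laurent_coeff f (- int n) * complex_of_real (2/r) ^ n"])
  then have "summable (\<lambda>n. norm (laurent_coeff f (- int n) * complex_of_real (1/r) ^ n))"
    by (rule powser_insidea) (use r in \<open>auto simp: norm_divide field_simps\<close>)
  then have "summable (\<lambda>n. norm (laurent_coeff f (- int (Suc n)) * complex_of_real (1/r) ^ Suc n))"
    by (simp only: summable_Suc_iff[of "\<lambda>n. norm (laurent_coeff f (- int n) * complex_of_real
      (1/r) ^ n)"])
  then show "summable (\<lambda>n. norm (laurent_coeff f (- int (Suc n))) * r powi (- int (Suc n)))"
    using r by (simp add: norm_mult norm_power norm_inverse powi_minus_Suc divide_inverse del: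
      of_nat_Suc power_Suc)
qed

text \<open>The zeroth coefficient of the Cauchy product of two Laurent series. Sums over all integers are split
  into nonnegative and negative indices throughout.\<close>

lemma laurent_coeff_0_mult_sums:
  assumes f: "f holomorphic_on ball 0 R - {0}" and g: "g holomorphic_on ball 0 R - {0}" and R: "0 < R"
  obtains P Q where "(\<lambda>n. laurent_coeff g (int n) * laurent_coeff f (- int n)) sums P"
    and "(\<lambda>n. laurent_coeff g (- int (Suc n)) * laurent_coeff f (int (Suc n))) sums Q"
    and "laurent_coeff (\<lambda>w. f w * g w) 0 = P + Q"
proof -
  define r where "r = R / 2"
  have r: "0 < r" "r < R" using R by (auto simp: r_def)
  define P where "P w = (\<Sum>n. laurent_coeff g (int n) * w powi int n)" for w
  define Q where "Q w = (\<Sum>n. laurent_coeff g (- int (Suc n)) * w powi (- int (Suc n)))" for w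
  have PQ: "(\<lambda>n. laurent_coeff g (int n) * w powi int n) sums P w"
      "(\<lambda>n. laurent_coeff g (- int (Suc n)) * w powi (- int (Suc n))) sums Q w"
      "g w = P w + Q w" if "norm w = r" for w
  proof -
    from that r have "w \<noteq> 0" "norm w < R" by auto
    then obtain P' Q' where PQ':
        "(\<lambda>n. laurent_coeff g (int n) * w powi int n) sums P'"
        "(\<lambda>n. laurent_coeff g (- int (Suc n)) * w powi (- int (Suc n))) sums Q'"
        "g w = P' + Q'"
      by (rule laurent_expansion[OF g])
    have "P' = P w" "Q' = Q w"
      unfolding P_def Q_def by (rule sums_unique, rule PQ')+
    with PQ' show "(\<lambda>n. laurent_coeff g (int n) * w powi int n) sums P w"
      "(\<lambda>n. laurent_coeff g (- int (Suc n)) * w powi (- int (Suc n))) sums Q w"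
      "g w = P w + Q w"
      by (simp_all only:)
  qed
  let ?I = "\<lambda>P. contour_integral (circlepath 0 r) (\<lambda>w. f w * P w / w)"
  note 1 = laurent_coeff_termwise[OF f r PQ(1) laurent_coeff_summable(1)[OF g r]]
  note 2 = laurent_coeff_termwise[OF f r PQ(2) laurent_coeff_summable(2)[OF g r]]
  have "2 * pi * \<i> * laurent_coeff (\<lambda>w. f w * g w) 0 = ?I g"
    using has_contour_integral_circle_laurent_coeff[OF holomorphic_on_mult[OF f g] r, of 0]
    by (simp add: contour_integral_unique power_int_minus divide_inverse)
  also have "?I g = contour_integral (circlepath 0 r) (\<lambda>w. f w * P w / w + f w * Q w / w)"
    using r by (intro contour_integral_cong) (auto simp: PQ(3) field_simps)
  also have "\<dots> = ?I P + ?I Q"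
    by (rule contour_integral_add[OF 1(1) 2(1)])
  finally have "laurent_coeff (\<lambda>w. f w * g w) 0 = ?I P / (2 * pi * \<i>) + ?I Q / (2 * pi * \<i>)"
    by (simp add: field_simps)
  moreover have "(\<lambda>n. laurent_coeff g (int n) * laurent_coeff f (- int n)) sums (?I P / (2 * pi * \<i>))"
    by (rule 1(2))
  moreover have "(\<lambda>n. laurent_coeff g (- int (Suc n)) * laurent_coeff f (int (Suc n)))
    sums (?I Q / (2 * pi * \<i>))"
    using 2(2) by (simp only: minus_minus)
  ultimately show ?thesis using that by blast
qed

section \<open>Means of holomorphic functions over the exponential Hartogs triangle\<close>

abbreviation HT :: "complex2 set" where "HT \<equiv> exp_hartogs_triangle"
abbreviation \<mu> :: "complex2 measure" where "\<mu> \<equiv> lebesgue_on exp_hartogs_triangle"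

lemma mem_HT_iff:
  "z \<in> HT \<longleftrightarrow> snd z \<noteq> 0 \<and> norm (snd z) < 1 \<and> norm (fst z) < exp (- 1 / norm (snd z))"
  by (cases z) (auto simp: exp_hartogs_triangle_def punctured_disc_def)

lemma open_HT: "open HT"
proof -
  let ?A = "(UNIV \<times> (ball 0 1 - {0})) :: complex2 set"
  have "continuous_on ?A (\<lambda>z. exp (- 1 / norm (snd z)) - norm (fst z))"
    by (intro continuous_intros) auto
  then have "open (?A \<inter> (\<lambda>z. exp (- 1 / norm (snd z)) - norm (fst z)) -` {0<..})"
    by (rule continuous_open_preimage) (auto intro!: open_Times)
  also have "?A \<inter> (\<lambda>z. exp (- 1 / norm (snd z)) - norm (fst z)) -` {0<..} = HT"
    by (auto simp: mem_HT_iff)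
  finally show ?thesis .
qed

lemma sets_HT [measurable, simp]: "HT \<in> sets borel" "HT \<in> sets lebesgue"
  using open_HT by (auto intro: borel_open)

lemma HT_rotate_fst: "norm u = 1 \<Longrightarrow> (u * fst z, snd z) \<in> HT \<longleftrightarrow> z \<in> HT"
  and HT_rotate_snd: "norm u = 1 \<Longrightarrow> (fst z, u * snd z) \<in> HT \<longleftrightarrow> z \<in> HT"
  by (auto simp: mem_HT_iff norm_mult)

lemma borel_measurable_HT_continuous:
  fixes f :: "complex2 \<Rightarrow> 'b::real_normed_vector"
  assumes "continuous_on HT f"
  shows "f \<in> borel_measurable \<mu>" and "(\<lambda>z. indicator HT z *\<^sub>R f z) \<in> borel_measurable borel"
  by (rule continuous_imp_measurable_on_sets_lebesgue[OF assms sets_HT(2)])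
    (rule borel_measurable_continuous_on_indicator[OF sets_HT(1) assms])

lemma integral_HT_eq:
  fixes f :: "complex2 \<Rightarrow> 'b::{banach, second_countable_topology}"
  assumes f: "continuous_on HT f"
  shows integrable_HT_iff: "integrable \<mu> f \<longleftrightarrow> integrable lborel (\<lambda>z. indicator HT z *\<^sub>R f z)"
    and integral_HT_lborel: "(LINT z|\<mu>. f z) = (LINT z|lborel. indicator HT z *\<^sub>R f z)"
proof -
  have m: "(\<lambda>z. indicator HT z *\<^sub>R f z) \<in> borel_measurable lborel"
    using borel_measurable_HT_continuous(2)[OF f] by simp
  have HT: "HT \<inter> space lebesgue \<in> sets lebesgue" by simp
  show "integrable \<mu> f \<longleftrightarrow> integrable lborel (\<lambda>z. indicator HT z *\<^sub>R f z)"
    unfolding integrable_restrict_space[OF HT] integrable_completion[OF m] ..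
  show "(LINT z|\<mu>. f z) = (LINT z|lborel. indicator HT z *\<^sub>R f z)"
    unfolding integral_restrict_space[OF HT] integral_completion[OF m] ..
qed

lemma complex_differentiable_at_imp_continuous:
  assumes "\<And>z. z \<in> S \<Longrightarrow> complex_differentiable_at f z"
  shows "continuous_on S f"
  using assms unfolding complex_differentiable_at_def
  by (intro continuous_at_imp_continuous_on) (blast intro: has_derivative_continuous)

lemma complex_differentiable_at_slice_fst:
  assumes "complex_differentiable_at f (a, w)"
  shows "(\<lambda>a. f (a, w)) field_differentiable at a"
proof -
  from assms obtain D where D: "(f has_derivative D) (at (a, w))"
    and lin: "\<And>c v. D (c * fst v, c * snd v) = c * D v"
    by (auto simp only: complex_differentiable_at_def)
  have "((\<lambda>a. f (a, w)) has_derivative (\<lambda>h. D (h, 0))) (at a)"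
    by (rule has_derivative_compose[where g=f
      and f="\<lambda>a. (a, w)", OF _ D]) (auto intro!: derivative_eq_intros)
  also have "(\<lambda>h. D (h, 0)) = (*) (D (1, 0))"
  proof
    show "D (h, 0) = D (1, 0) * h" for h
      using lin[of h "(1, 0)"] by (simp add: mult.commute)
  qed
  finally show ?thesis
    by (auto simp: field_differentiable_def has_field_derivative_def)
qed

lemma complex_differentiable_at_slice_snd:
  assumes "complex_differentiable_at f (a, w)"
  shows "(\<lambda>w. f (a, w)) field_differentiable at w"
proof -
  from assms obtain D where D: "(f has_derivative D) (at (a, w))"
    and lin: "\<And>c v. D (c * fst v, c * snd v) = c * D v"
    by (auto simp only: complex_differentiable_at_def)
  have "((\<lambda>w. f (a, w)) has_derivative (\<lambda>h. D (0, h))) (at w)"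
    by (rule has_derivative_compose[where g=f
      and f="\<lambda>w. (a, w)", OF _ D]) (auto intro!: derivative_eq_intros)
  also have "(\<lambda>h. D (0, h)) = (*) (D (0, 1))"
  proof
    show "D (0, h) = D (0, 1) * h" for h
      using lin[of h "(0, 1)"] by (simp add: mult.commute)
  qed
  finally show ?thesis
    by (auto simp: field_differentiable_def has_field_derivative_def)
qed

lemma complex_differentiable_at_mult:
  assumes "complex_differentiable_at f z" "complex_differentiable_at g z"
  shows "complex_differentiable_at (\<lambda>z. f z * g z) z"
proof -
  from assms obtain D E where *: "(f has_derivative D) (at z)" "\<And>c v. D (c * fst v, c * snd v) = c * D v"
    "(g has_derivative E) (at z)" "\<And>c v. E (c * fst v, c * snd v) = c * E v"
    by (auto simp only: complex_differentiable_at_def)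
  show ?thesis
    unfolding complex_differentiable_at_def
    by (rule exI, rule conjI, rule has_derivative_mult[OF *(1,3)]) (simp add: * algebra_simps)
qed

lemma complex_differentiable_at_diff:
  assumes "complex_differentiable_at f z" "complex_differentiable_at g z"
  shows "complex_differentiable_at (\<lambda>z. f z - g z) z"
proof -
  from assms obtain D E where *: "(f has_derivative D) (at z)" "\<And>c v. D (c * fst v, c * snd v) = c * D v"
    "(g has_derivative E) (at z)" "\<And>c v. E (c * fst v, c * snd v) = c * E v"
    by (auto simp only: complex_differentiable_at_def)
  show ?thesis
    unfolding complex_differentiable_at_def
    by (rule exI, rule conjI, rule has_derivative_diff[OF *(1,3)]) (simp add: * algebra_simps)
qed

lemma complex_differentiable_at_snd:
  assumes "f field_differentiable at (snd z)"
  shows "complex_differentiable_at (\<lambda>z. f (snd z)) z"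
proof -
  from assms obtain f' where f': "(f has_derivative (*) f') (at (snd z))"
    by (auto simp: field_differentiable_def has_field_derivative_def)
  have "((\<lambda>z. f (snd z)) has_derivative (\<lambda>v. f' * snd v)) (at z)"
    by (rule has_derivative_compose[where g=f and f=snd, OF _ f']) (auto intro!: derivative_eq_intros)
  then show ?thesis
    unfolding complex_differentiable_at_def by (intro exI[of _ "\<lambda>v. f' * snd v"]) auto
qed

lemma complex_differentiable_at_cong_open:
  assumes "complex_differentiable_at f z" "open S" "z \<in> S" "\<And>z. z \<in> S \<Longrightarrow> f z = g z"
  shows "complex_differentiable_at g z"
proof -
  from assms(1) obtain D where *: "(f has_derivative D) (at z)" "\<And>c v. D (c * fst v, c * snd v)
    = c * D v"
    by (auto simp only: complex_differentiable_at_def)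
  have "(g has_derivative D) (at z)"
    by (rule has_derivative_transform_within_open[OF *(1) assms(2-4)])
  with * show ?thesis unfolding complex_differentiable_at_def by blast
qed

lemma holomorphic_slice_snd:
  assumes "\<And>z. z \<in> HT \<Longrightarrow> complex_differentiable_at G z"
  shows "(\<lambda>w. G (0, w)) holomorphic_on ball 0 1 - {0}"
  unfolding holomorphic_on_def
proof
  fix w :: complex assume "w \<in> ball 0 1 - {0}"
  then have "(0, w) \<in> HT" by (auto simp: mem_HT_iff)
  from complex_differentiable_at_slice_snd[OF assms[OF this]]
  show "(\<lambda>w. G (0, w)) field_differentiable at w within ball 0 1 - {0}"
    by (rule field_differentiable_at_within)
qed

lemma set_integral_circle_fst:
  assumes G: "\<And>z. z \<in> HT \<Longrightarrow> complex_differentiable_at G z" and z: "z \<in> HT"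
  shows "(LINT t:{0..1}|lborel. G (exp (2 * of_real pi * \<i> * of_real t) * fst z, snd z)) = G (0, snd z)"
proof (cases "fst z = 0")
  case True
  then show ?thesis by (simp add: set_lebesgue_integral_def)
next
  case False
  let ?R = "exp (- 1 / norm (snd z))"
  have hol: "(\<lambda>a. G (a, snd z)) holomorphic_on ball 0 ?R"
    unfolding holomorphic_on_def
  proof
    fix a :: complex assume "a \<in> ball 0 ?R"
    then have "(a, snd z) \<in> HT" using z by (auto simp: mem_HT_iff)
    from complex_differentiable_at_slice_fst[OF G[OF this]]
    show "(\<lambda>a. G (a, snd z)) field_differentiable at a within ball 0 ?R"
      by (rule field_differentiable_at_within)
  qed
  have "(LINT t:{0..1}|lborel. G (exp (2 * of_real pi * \<i> * of_real t) * fst z, snd z))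
      = laurent_coeff (\<lambda>a. G (a, snd z)) 0"
    by (rule set_integral_circle_mean[of "\<lambda>a. G (a, snd z)" ?R])
      (use False z hol in \<open>auto simp: mem_HT_iff intro: holomorphic_on_subset\<close>)
  also have "\<dots> = G (0, snd z)"
    using laurent_coeff_holomorphic[OF hol] by simp
  finally show ?thesis .
qed

text \<open>The mean value property that carries the whole computation. Averaging over rotations of the
  first variable uses the mean value property of a disc, and averaging over rotations of the second
  one the mean over a circle around the puncture.\<close>

lemma integral_HT_radial_mult_holomorphic:
  fixes \<rho> :: "real \<Rightarrow> real"
  assumes G: "\<And>z. z \<in> HT \<Longrightarrow> complex_differentiable_at G z"
    and \<rho>: "continuous_on {0<..<1} \<rho>"
    and int: "integrable \<mu> (\<lambda>z. \<rho> (norm (snd z)) *\<^sub>R G z)"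
  shows "(LINT z|\<mu>. \<rho> (norm (snd z)) *\<^sub>R G z)
       = (LINT z|\<mu>. \<rho> (norm (snd z))) *\<^sub>R laurent_coeff (\<lambda>w. G (0, w)) 0"
proof -
  let ?u = "\<lambda>t::real. exp (2 * of_real pi * \<i> * of_real t)"
  let ?L = "laurent_coeff (\<lambda>w. G (0, w)) 0"
  have nu: "norm (?u t) = 1" for t by simp
  have cont_\<rho>: "continuous_on HT (\<lambda>z. \<rho> (norm (snd z)))"
    by (rule continuous_on_compose2[OF \<rho>]) (auto intro!: continuous_intros simp: mem_HT_iff)
  have cont: "continuous_on HT (\<lambda>z. \<rho> (norm (snd z)) *\<^sub>R G z)"
    by (intro continuous_on_scaleR cont_\<rho> complex_differentiable_at_imp_continuous G)
  define \<Phi> where "\<Phi> z = indicator HT z *\<^sub>R (\<rho> (norm (snd z)) *\<^sub>R G z)" for z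
  define \<Psi> where "\<Psi> z = indicator HT z *\<^sub>R (\<rho> (norm (snd z)) *\<^sub>R G (0, snd z))" for z
  have \<Phi>: "integrable lborel \<Phi>"
    using int unfolding integrable_HT_iff[OF cont] \<Phi>_def .
  have avg1: "(LINT s:{0..1}|lborel. \<Phi> (?u s * fst z, snd z)) = \<Psi> z" for z
    using set_integral_circle_fst[OF G, of z]
    by (cases "z \<in> HT")
      (simp_all add: \<Phi>_def \<Psi>_def indicator_def HT_rotate_fst[OF nu])
  have meas1: "(\<lambda>(s, z :: complex2). (?u s * fst z, snd z)) \<in> borel_measurable borel"
    by (intro borel_measurable_continuous_onI) (auto simp: case_prod_unfold intro!: continuous_intros)
  have inv1: "distr lborel borel (\<lambda>z :: complex2. (?u s * fst z, snd z)) = lborel" for s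
    using lborel_distr_bi_rotation[of "?u s" 1] by (simp add: case_prod_unfold)
  note 1 = integral_average_measure_preserving[where T="\<lambda>s z :: complex2. (?u s
    * fst z, snd z)", OF meas1 inv1 \<Phi>]
  have \<Psi>: "integrable lborel \<Psi>" and eq1: "(LINT z|lborel. \<Psi> z) = (LINT z|lborel. \<Phi> z)"
    using 1 by (simp_all only: avg1)
  have avg2: "(LINT s:{0..1}|lborel. \<Psi> (fst z, ?u s * snd z))
    = (indicator HT z * \<rho> (norm (snd z))) *\<^sub>R ?L" for z
    using set_integral_circle_mean[OF holomorphic_slice_snd[OF G], of "snd z"]
    by (cases "z \<in> HT")
      (simp_all add: \<Psi>_def indicator_def HT_rotate_snd[OF nu] norm_mult, simp add: mem_HT_iff)
  have meas2: "(\<lambda>(s, z :: complex2). (fst z, ?u s * snd z)) \<in> borel_measurable borel"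
    by (intro borel_measurable_continuous_onI) (auto simp: case_prod_unfold intro!: continuous_intros)
  have inv2: "distr lborel borel (\<lambda>z :: complex2. (fst z, ?u s * snd z)) = lborel" for s
    using lborel_distr_bi_rotation[of 1 "?u s"] by (simp add: case_prod_unfold)
  note 2 = integral_average_measure_preserving[where T="\<lambda>s z :: complex2. (fst z, ?u s
    * snd z)", OF meas2 inv2 \<Psi>]
  have "(LINT z|\<mu>. \<rho> (norm (snd z)) *\<^sub>R G z) = (LINT z|lborel. \<Phi> z)"
    unfolding integral_HT_lborel[OF cont] \<Phi>_def ..
  also have "\<dots> = (LINT z|lborel. (indicator HT z * \<rho> (norm (snd z))) *\<^sub>R ?L)"
    using 2(2) by (simp only: avg2 eq1)
  also have "\<dots> = (LINT z|lborel. indicator HT z *\<^sub>R \<rho> (norm (snd z))) *\<^sub>R ?L"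
    by (simp add: scaleR_conv_of_real del: of_real_mult)
  finally show ?thesis unfolding integral_HT_lborel[OF cont_\<rho>] .
qed

section \<open>Square-integrable functions and the monomials\<close>

lemma integrable_mult_of_square_integrable:
  fixes f g :: "'a \<Rightarrow> complex"
  assumes [measurable]: "f \<in> borel_measurable M" "g \<in> borel_measurable M"
    and "integrable M (\<lambda>x. (norm (f x))\<^sup>2)" "integrable M (\<lambda>x. (norm (g x))\<^sup>2)"
  shows "integrable M (\<lambda>x. f x * g x)"
proof (rule Bochner_Integration.integrable_bound)
  show "integrable M (\<lambda>x. (norm (f x))\<^sup>2 + (norm (g x))\<^sup>2)"
    using assms by simp
  have "norm (f x * g x) \<le> norm ((norm (f x))\<^sup>2 + (norm (g x))\<^sup>2)" for x
  proof -
    have "0 \<le> norm (f x) * norm (g x)" by simp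
    with sum_squares_bound[of "norm (f x)" "norm (g x)"]
    have "norm (f x) * norm (g x) \<le> (norm (f x))\<^sup>2 + (norm (g x))\<^sup>2" by linarith
    then show ?thesis unfolding norm_mult by simp
  qed
  then show "AE x in M. norm (f x * g x) \<le> norm ((norm (f x))\<^sup>2 + (norm (g x))\<^sup>2)"
    by simp
qed measurable

lemma integral_Cauchy_Schwarz:
  fixes f g :: "'a \<Rightarrow> complex"
  assumes [measurable]: "f \<in> borel_measurable M" "g \<in> borel_measurable M"
    and f: "integrable M (\<lambda>x. (norm (f x))\<^sup>2)" and g: "integrable M (\<lambda>x. (norm (g x))\<^sup>2)"
  shows "norm (LINT x|M. f x * g x)
    \<le> sqrt (LINT x|M. (norm (f x))\<^sup>2) * sqrt (LINT x|M. (norm (g x))\<^sup>2)"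
proof -
  let ?A = "LINT x|M. (norm (f x))\<^sup>2" and ?B = "LINT x|M. (norm (g x))\<^sup>2"
    and ?C = "LINT x|M. norm (f x) * norm (g x)"
  have fg: "integrable M (\<lambda>x. norm (f x) * norm (g x))"
    using integrable_norm[OF integrable_mult_of_square_integrable[OF assms]] by (simp add: norm_mult)
  \<comment> \<open>The quadratic polynomial behind the Cauchy-Schwarz inequality, to be evaluated at \<open>t = ?C / ?B\<close>.\<close>
  have quad: "0 \<le> ?A - 2 * t * ?C + t\<^sup>2 * ?B" for t
  proof -
    have "0 \<le> (LINT x|M. (norm (f x) - t * norm (g x))\<^sup>2)" by simp
    also have "(\<lambda>x. (norm (f x) - t * norm (g x))\<^sup>2)
        = (\<lambda>x. (norm (f x))\<^sup>2 - 2 * t * (norm (f x) * norm (g x)) + t\<^sup>2 * (norm (g x))\<^sup>2)"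
      by (auto simp: power2_eq_square algebra_simps)
    also have "(LINT x|M. \<dots> x) = ?A - 2 * t * ?C + t\<^sup>2 * ?B"
      using f g fg by simp
    finally show ?thesis .
  qed
  have C0: "0 \<le> ?C" and B0: "0 \<le> ?B" by (auto intro!: integral_nonneg_AE)
  have "?C\<^sup>2 \<le> ?A * ?B"
  proof (cases "?B = 0")
    case True
    have "?C = 0"
    proof (rule ccontr)
      assume "?C \<noteq> 0"
      then show False
        using quad[of "(?A + 1) / (2 * ?C)"] True by simp
    qed
    then show ?thesis using True by simp
  next
    case False
    then have "0 < ?B" using B0 by (metis order_le_less)
    then show ?thesis
      using quad[of "?C / ?B"] by (simp add: field_simps power2_eq_square)
  qed
  then have "?C \<le> sqrt ?A * sqrt ?B"
    by (metis real_le_rsqrt real_sqrt_mult)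
  moreover have "norm (LINT x|M. f x * g x) \<le> ?C"
    using integral_norm_bound[of M "\<lambda>x. f x * g x"] by (simp add: norm_mult)
  ultimately show ?thesis by linarith
qed

lemma A_space_2_iff:
  "f \<in> A_space 2 HT \<longleftrightarrow> f \<in> holomorphic_functions HT \<and> integrable \<mu> (\<lambda>z. (norm (f z))\<^sup>2)"
proof -
  have "f \<in> borel_measurable \<mu>" if "f \<in> holomorphic_functions HT"
    using that by (intro borel_measurable_HT_continuous complex_differentiable_at_imp_continuous)
      (auto simp: holomorphic_functions_def)
  then show ?thesis
    by (auto simp: A_space_def Lp_space_def)
qed

lemma A_space_2D:
  assumes "f \<in> A_space 2 HT"
  shows "\<And>z. z \<in> HT \<Longrightarrow> complex_differentiable_at f z"
    and "\<And>z. z \<notin> HT \<Longrightarrow> f z = 0"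
    and "continuous_on HT f" and "f \<in> borel_measurable \<mu>"
    and "integrable \<mu> (\<lambda>z. (norm (f z))\<^sup>2)"
proof -
  show *: "\<And>z. z \<in> HT \<Longrightarrow> complex_differentiable_at f z"
    using assms by (auto simp: A_space_2_iff holomorphic_functions_def)
  show "\<And>z. z \<notin> HT \<Longrightarrow> f z = 0" "integrable \<mu> (\<lambda>z. (norm (f z))\<^sup>2)"
    using assms by (auto simp: A_space_2_iff holomorphic_functions_def)
  show "continuous_on HT f"
    by (rule complex_differentiable_at_imp_continuous[OF *])
  then show "f \<in> borel_measurable \<mu>"
    by (rule borel_measurable_HT_continuous)
qed

lemma Lp_norm_2: "Lp_norm 2 HT f = sqrt (LINT z|\<mu>. (norm (f z))\<^sup>2)"
  by (simp add: Lp_norm_def powr_half_sqrt)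

lemma emeasure_complex_ball:
  fixes c :: complex
  assumes "0 \<le> r"
  shows "emeasure lborel (ball c r) = ennreal (pi * r\<^sup>2)"
  using emeasure_ball[OF assms, of c] by (simp add: unit_ball_vol_2)

text \<open>The fibre over \<open>w\<close> is a disc of area \<open>\<pi> exp (- 2 / \<bar>w\<bar>)\<close>, so the integrand cancels exactly against the
  size of the fibre.\<close>

lemma integrable_HT_exp: "integrable \<mu> (\<lambda>z. exp (2 / norm (snd z)))"
proof -
  have cont: "continuous_on HT (\<lambda>z. exp (2 / norm (snd z)))"
    by (intro continuous_intros) (auto simp: mem_HT_iff)
  let ?F = "\<lambda>z. indicator HT z *\<^sub>R exp (2 / norm (snd z))"
  have F: "?F \<in> borel_measurable lborel"
    using borel_measurable_HT_continuous(2)[OF cont] by simp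
  have "integrable lborel ?F"
  proof (rule integrableI_bounded)
    have "(\<integral>\<^sup>+ z. ennreal (norm (?F z)) \<partial>lborel) = (\<integral>\<^sup>+ z. ennreal (?F z) \<partial>(lborel \<Otimes>\<^sub>M lborel))"
      by (simp add: lborel_prod indicator_def)
    also have "\<dots> = (\<integral>\<^sup>+ w. (\<integral>\<^sup>+ a. ennreal (?F (a, w)) \<partial>lborel) \<partial>lborel)"
      by (rule lborel_pair.nn_integral_snd[symmetric]) (use F in \<open>simp add: lborel_prod\<close>)
    also have "\<dots> \<le> (\<integral>\<^sup>+ w. ennreal pi * indicator (ball 0 1) (w :: complex) \<partial>lborel)"
    proof (rule nn_integral_mono)
      fix w :: complex
      show "(\<integral>\<^sup>+ a. ennreal (?F (a, w)) \<partial>lborel) \<le> ennreal pi * indicator (ball 0 1) w"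
      proof (cases "w \<noteq> 0 \<and> norm w < 1")
        case True
        have "(\<integral>\<^sup>+ a. ennreal (?F (a, w)) \<partial>lborel)
            = (\<integral>\<^sup>+ a. ennreal (exp (2 / norm w)) * indicator (ball (0 :: complex) (exp (- 1
              / norm w))) a \<partial>lborel)"
          using True by (intro nn_integral_cong) (auto simp: mem_HT_iff indicator_def)
        also have "\<dots> = ennreal (exp (2 / norm w)) * ennreal (pi * (exp (- 1 / norm w))\<^sup>2)"
          by (subst nn_integral_cmult_indicator) (auto simp: emeasure_complex_ball)
        also have "\<dots> = ennreal pi"
          by (simp add: ennreal_mult''[symmetric] power2_eq_square exp_minus field_simps flip: exp_add)
        finally show ?thesis using True by simp
      next
        case False
        then have "\<And>a. ?F (a, w) = 0" by (auto simp: mem_HT_iff indicator_def)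
        then show ?thesis by simp
      qed
    qed
    also have "\<dots> = ennreal pi * ennreal pi"
      by (subst nn_integral_cmult_indicator) (auto simp: emeasure_complex_ball)
    also have "\<dots> < \<infinity>"
      by (simp add: ennreal_mult_less_top)
    finally show "(\<integral>\<^sup>+ z. ennreal (norm (?F z)) \<partial>lborel) < \<infinity>" .
  qed (rule F)
  then show ?thesis unfolding integrable_HT_iff[OF cont] .
qed

lemma integrable_HT_bound_exp:
  fixes f :: "complex2 \<Rightarrow> 'b::{banach, second_countable_topology}"
  assumes "continuous_on HT f" and "\<And>z. z \<in> HT \<Longrightarrow> norm (f z) \<le> C * exp (2 / norm (snd z))"
  shows "integrable \<mu> f"
proof (rule Bochner_Integration.integrable_bound)
  show "integrable \<mu> (\<lambda>z. C * exp (2 / norm (snd z)))"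
    using integrable_HT_exp by simp
  show "f \<in> borel_measurable \<mu>"
    by (rule borel_measurable_HT_continuous[OF assms(1)])
  show "AE z in \<mu>. norm (f z) \<le> norm (C * exp (2 / norm (snd z)))"
    using assms(2) by (intro AE_I2) force
qed

definition monomial_norm_sq :: "int \<Rightarrow> real" where
  "monomial_norm_sq k = (LINT z|\<mu>. norm (snd z) powi (2 * k))"

lemma power_le_fact_mult_exp: "0 \<le> x \<Longrightarrow> x ^ n \<le> fact n * exp x" for x :: real
proof -
  assume x: "0 \<le> x"
  have "x ^ n / fact n \<le> (\<Sum>k. x ^ k /\<^sub>R fact k)"
    using sum_le_suminf[OF summable_exp_generic[of x], of "{n}"] x
      by (simp add: divide_inverse mult.commute)
  then show ?thesis by (simp add: exp_def field_simps)
qed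

lemma powi_bound_exp:
  fixes w :: complex
  assumes "0 < norm w" "norm w < 1"
  shows "norm w powi k \<le> fact (nat \<bar>k\<bar>) * exp (1 / norm w)"
proof (cases "k \<ge> 0")
  case True
  have "norm w powi k \<le> 1"
    using assms True by (simp add: power_int_def power_le_one)
  also have "\<dots> \<le> fact (nat \<bar>k\<bar>) * exp (1 / norm w)"
    using mult_mono[of 1 "fact (nat \<bar>k\<bar>)" 1 "exp (1 / norm w)"] by (simp add: fact_ge_1)
  finally show ?thesis .
next
  case False
  then have "norm w powi k = (1 / norm w) ^ nat \<bar>k\<bar>"
    by (simp add: power_int_def divide_inverse)
  then show ?thesis using power_le_fact_mult_exp[of "1 / norm w"] by simp
qed

lemma continuous_on_HT_powi:
  "continuous_on HT (\<lambda>z. norm (snd z) powi k)" "continuous_on HT (\<lambda>z. snd z powi k)"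
  by (auto intro!: continuous_intros simp: mem_HT_iff)

lemma integrable_HT_norm_powi: "integrable \<mu> (\<lambda>z. norm (snd z) powi k)"
proof (rule integrable_HT_bound_exp)
  fix z assume z: "z \<in> HT"
  have "norm (snd z) powi k \<le> fact (nat \<bar>k\<bar>) * exp (1 / norm (snd z))"
    using powi_bound_exp[of "snd z"] z by (auto simp: mem_HT_iff)
  also have "\<dots> \<le> fact (nat \<bar>k\<bar>) * exp (2 / norm (snd z))"
    by (intro mult_left_mono) (auto intro: divide_right_mono)
  finally show "norm (norm (snd z) powi k) \<le> fact (nat \<bar>k\<bar>) * exp (2 / norm (snd z))"
    by simp
qed (rule continuous_on_HT_powi)

lemma norm_powi_square: "(norm (w powi k))\<^sup>2 = norm w powi (2 * k)" for w :: complex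
  by (simp add: norm_power_int power_int_mult mult.commute[of 2])

lemma complex_differentiable_at_HT_powi:
  "z \<in> HT \<Longrightarrow> complex_differentiable_at (\<lambda>z. snd z powi k) z"
  by (rule complex_differentiable_at_snd)
    (auto intro!: derivative_intros simp: mem_HT_iff field_differentiable_def)

text \<open>On the domain \<open>cnj (w\<^sup>k) = \<bar>w\<bar>\<^sup>2\<^sup>k w\<^sup>-\<^sup>k\<close>, a radial weight times a holomorphic function.\<close>

lemma integral_mult_cnj_monomial:
  assumes f: "f \<in> A_space 2 HT"
  shows "(LINT z|\<mu>. f z * cnj (snd z powi k))
       = monomial_norm_sq k * laurent_coeff (\<lambda>w. f (0, w)) k"
proof -
  have "integrable \<mu> (\<lambda>z. f z * cnj (snd z powi k))"
    by (rule integrable_mult_of_square_integrable)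
      (use A_space_2D[OF f] integrable_HT_norm_powi[of "2 * k"]
        borel_measurable_HT_continuous(1)[OF continuous_on_cnj[OF continuous_on_HT_powi(2)], of k]
        in \<open>simp_all add: norm_powi_square del: complex_cnj_power_int\<close>)
  moreover have eq: "f z * cnj (snd z powi k) = norm (snd z) powi (2 * k) *\<^sub>R (f z * snd z powi (- k))"
    if "z \<in> HT" for z
  proof -
    define c where "c = snd z powi k"
    have "c \<noteq> 0" using that by (auto simp: c_def mem_HT_iff)
    moreover have "c * cnj c = of_real (norm (snd z) powi (2 * k))"
      unfolding norm_powi_square[symmetric] c_def by (rule complex_norm_square[symmetric])
    moreover have "f z * cnj c = f z * inverse c * (c * cnj c)"
      using \<open>c \<noteq> 0\<close> by simp
    ultimately show ?thesis
      unfolding power_int_minus c_def[symmetric] scaleR_conv_of_real by (simp only: mult.commute)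
  qed
  ultimately have int: "integrable \<mu> (\<lambda>z. norm (snd z) powi (2 * k) *\<^sub>R (f z * snd z powi (- k)))"
    by (subst (asm) Bochner_Integration.integrable_cong[OF refl eq]) auto
  have "(LINT z|\<mu>. f z * cnj (snd z powi k))
    = (LINT z|\<mu>. norm (snd z) powi (2 * k) *\<^sub>R (f z * snd z powi (- k)))"
    by (intro Bochner_Integration.integral_cong refl eq) simp
  also have "\<dots> = monomial_norm_sq k *\<^sub>R laurent_coeff (\<lambda>w. f (0, w) * w powi (- k)) 0"
    unfolding monomial_norm_sq_def
    using integral_HT_radial_mult_holomorphic[where G="\<lambda>z. f z * snd z powi (- k)"
      and \<rho>="\<lambda>r. r powi (2 * k)", OF _ _ int]
    by (simp add: complex_differentiable_at_mult A_space_2D(1)[OF f]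
      complex_differentiable_at_HT_powi continuous_on_power_int)
  also have "laurent_coeff (\<lambda>w. f (0, w) * w powi (- k)) 0 = laurent_coeff (\<lambda>w. f (0, w)) k"
    using laurent_coeff_mult_powi[OF holomorphic_slice_snd[of f]] A_space_2D(1)[OF f] by simp
  finally show ?thesis by (simp add: scaleR_conv_of_real)
qed

lemma integral_mult_A_space:
  assumes f: "f \<in> A_space 2 HT" and g: "g \<in> A_space 2 HT"
  shows "(LINT z|\<mu>. f z * g z)
       = monomial_norm_sq 0 * laurent_coeff (\<lambda>w. f (0, w) * g (0, w)) 0"
proof -
  have "integrable \<mu> (\<lambda>z. f z * g z)"
    using A_space_2D[OF f] A_space_2D[OF g] by (intro integrable_mult_of_square_integrable)
  then show ?thesis
    using integral_HT_radial_mult_holomorphic[where G="\<lambda>z. f z * g z" and \<rho>="\<lambda>_. 1"]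
    by (simp add: complex_differentiable_at_mult A_space_2D(1)[OF f] A_space_2D(1)[OF g]
      monomial_norm_sq_def
        scaleR_conv_of_real)
qed

text \<open>A product of two discs inside the domain on which \<open>\<bar>w\<bar>\<close> is comparable to \<open>t\<close>. It bounds the monomial
  norms from below, and for small \<open>t\<close> it shows that \<open>1 / w\<close> is essentially unbounded.\<close>

definition inner_polydisc :: "real \<Rightarrow> complex2 set" where
  "inner_polydisc t = ball 0 (exp (- 2 / t)) \<times> ball (of_real (3 * t / 4)) (t / 4)"

lemma inner_polydisc_norm_snd:
  assumes "z \<in> inner_polydisc t"
  shows "t / 2 < norm (snd z)" "norm (snd z) < t"
proof -
  have d: "norm (of_real (3 * t / 4) - snd z) < t / 4"
    using assms by (auto simp: inner_polydisc_def dist_norm)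
  then have "0 < t" using norm_ge_zero[of "of_real (3 * t / 4) - snd z"] by linarith
  then have "norm (complex_of_real (3 * t / 4)) = 3 * t / 4" unfolding norm_of_real by simp
  then show "t / 2 < norm (snd z)" "norm (snd z) < t"
    using d norm_triangle_ineq2[of "complex_of_real (3 * t / 4)" "snd z"]
      norm_triangle_ineq2[of "snd z" "complex_of_real (3 * t / 4)"]
    by (simp_all add: norm_minus_commute)
qed

lemma inner_polydisc_subset:
  assumes "0 < t" "t \<le> 1"
  shows "inner_polydisc t \<subseteq> HT"
proof
  fix z assume z: "z \<in> inner_polydisc t"
  note n = inner_polydisc_norm_snd[OF z]
  have "1 / norm (snd z) \<le> 2 / t"
    using n assms frac_le[of 1 1 "t / 2" "norm (snd z)"] by simp
  then have "exp (- 2 / t) \<le> exp (- 1 / norm (snd z))" by simp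
  moreover have "norm (fst z) < exp (- 2 / t)"
    using z by (auto simp: inner_polydisc_def)
  ultimately have "norm (fst z) < exp (- 1 / norm (snd z))" by linarith
  then show "z \<in> HT"
    using n assms by (auto simp: mem_HT_iff)
qed

lemma emeasure_inner_polydisc:
  assumes "0 < t"
  shows "emeasure lborel (inner_polydisc t) = ennreal (pi\<^sup>2 / 16 * t\<^sup>2 * exp (- 4 / t))"
proof -
  have "emeasure lborel (inner_polydisc t) = ennreal (pi * (exp (- 2 / t))\<^sup>2) * ennreal (pi * (t / 4)\<^sup>2)"
    unfolding inner_polydisc_def lborel_prod[symmetric]
    using assms by (subst lborel.emeasure_pair_measure_Times) (auto simp: emeasure_complex_ball)
  also have "(exp (- 2 / t))\<^sup>2 = exp (- 4 / t)"
    by (simp add: power2_eq_square flip: exp_add)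
  finally show ?thesis
    by (simp add: ennreal_mult''[symmetric] power2_eq_square field_simps)
qed

lemma monomial_norm_sq_ge:
  assumes t: "0 < t" "t \<le> 1" and m: "0 \<le> m" "\<And>r. t / 2 < r \<Longrightarrow> r < t \<Longrightarrow> m \<le> r powi (2 * k)"
  shows "m * (pi\<^sup>2 / 16 * t\<^sup>2 * exp (- 4 / t)) \<le> monomial_norm_sq k"
proof -
  let ?B = "inner_polydisc t"
  have [measurable]: "?B \<in> sets borel"
    unfolding inner_polydisc_def by (intro borel_open open_Times) auto
  have "m * (pi\<^sup>2 / 16 * t\<^sup>2 * exp (- 4 / t)) = (LINT z|lborel. m * indicator ?B z)"
    using t by (simp add: measure_def emeasure_inner_polydisc)
  also have "\<dots> \<le> (LINT z|lborel. indicator HT z *\<^sub>R norm (snd z) powi (2 * k))"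
  proof (rule integral_mono)
    show "integrable lborel (\<lambda>z. m * indicator ?B z)"
      using t by (intro integrable_mult_right integrable_real_indicator)
        (auto simp: emeasure_inner_polydisc)
    show "integrable lborel (\<lambda>z. indicator HT z *\<^sub>R norm (snd z) powi (2 * k))"
      using integrable_HT_norm_powi[of "2 * k"]
        unfolding integrable_HT_iff[OF continuous_on_HT_powi(1)] .
    fix z :: complex2
    show "m * indicator ?B z \<le> indicator HT z *\<^sub>R norm (snd z) powi (2 * k)"
      using inner_polydisc_subset[OF t] m inner_polydisc_norm_snd[of z t]
      by (auto simp: indicator_def)
  qed
  finally show ?thesis
    unfolding monomial_norm_sq_def integral_HT_lborel[OF continuous_on_HT_powi(1)] .
qed

text \<open>The volume of \<open>inner_polydisc 1\<close>.\<close>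

definition inner_volume :: real where "inner_volume = pi\<^sup>2 / 16 * exp (- 4)"

lemma inner_volume_pos: "0 < inner_volume" by (simp add: inner_volume_def)

lemma monomial_norm_sq_nonneg_ge: "inner_volume / 4 ^ n \<le> monomial_norm_sq (int n)"
proof -
  have "(1/4) ^ n \<le> r powi (2 * int n)" if r: "1 / 2 < r" for r :: real
  proof -
    have "(1/4) ^ n = (1/2 :: real) ^ (2 * n)" by (simp add: power_mult power2_eq_square)
    also have "\<dots> \<le> r ^ (2 * n)" using r by (intro power_mono) auto
    also have "\<dots> = r powi (2 * int n)"
      using power_int_of_nat[of r "2 * n"] by simp
    finally show ?thesis .
  qed
  from monomial_norm_sq_ge[of 1 "(1/4) ^ n" "int n", OF _ _ _ this]
  show ?thesis by (simp add: inner_volume_def power_divide)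
qed

text \<open>The mass of \<open>\<bar>w\<bar>\<^sup>-\<^sup>2\<^sup>n\<close> sits near \<open>\<bar>w\<bar> = 1 / n\<close>. On the polydisc with \<open>t = 1 / (n + 1)\<close> this
  function is at least \<open>(n + 1)\<^sup>2\<^sup>n \<ge> (n!)\<^sup>2\<close>, and the volume of the polydisc costs a geometric factor only.\<close>

lemma monomial_norm_sq_neg_ge: "inner_volume * (fact n)\<^sup>2 / (4 * exp 4) ^ n \<le> monomial_norm_sq (- int n)"
proof -
  define N where "N = real (Suc n)"
  have N: "1 \<le> N" by (simp add: N_def)
  have "N ^ (2 * n) \<le> r powi (2 * (- int n))" if r: "1 / N / 2 < r" "r < 1 / N" for r :: real
  proof -
    have "0 < 1 / N / 2" using N by simp
    then have "0 < r" using r by linarith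
    then have "N \<le> inverse r" using r N by (simp add: field_simps)
    then have "N ^ (2 * n) \<le> inverse r ^ (2 * n)" using N by (intro power_mono) auto
    also have "\<dots> = r powi (2 * (- int n))"
      using power_int_of_nat[of r "2 * n"] by (simp add: power_int_minus power_inverse)
    finally show ?thesis .
  qed
  from monomial_norm_sq_ge[of "1 / N" "N ^ (2 * n)" "- int n", OF _ _ _ this] N
  have 1: "N ^ (2 * n) * (pi\<^sup>2 / 16 * (1 / N)\<^sup>2 * exp (- 4 * N)) \<le> monomial_norm_sq (- int n)"
    by simp
  have "fact n \<le> N ^ n"
  proof -
    have "fact n \<le> real n ^ n" using fact_le_power[of n, where 'a=real] by simp
    also have "\<dots> \<le> N ^ n" by (intro power_mono) (auto simp: N_def)
    finally show ?thesis .
  qed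
  then have "(fact n)\<^sup>2 \<le> (N ^ n)\<^sup>2"
    by (intro power_mono) auto
  then have f: "(fact n)\<^sup>2 \<le> N ^ (2 * n)"
    by (simp add: power_mult mult.commute)
  have "N \<le> 2 ^ n"
    unfolding N_def by (induction n) auto
  then have "N\<^sup>2 \<le> (2 ^ n)\<^sup>2" using N by (intro power_mono) auto
  also have "\<dots> = 4 ^ n" by (simp add: power2_eq_square flip: power_mult_distrib)
  finally have "1 / 4 ^ n \<le> (1 / N)\<^sup>2"
    using N by (simp add: power_divide field_simps)
  have "exp (- 4 * N) = exp (- 4) / exp 4 ^ n"
  proof -
    have "exp (- 4 * N) = exp (- 4 - real n * 4)" by (simp add: N_def algebra_simps)
    then show ?thesis unfolding exp_diff exp_of_nat_mult .
  qed
  have "inner_volume * (fact n)\<^sup>2 / (4 * exp 4) ^ n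
    = (fact n)\<^sup>2 * (pi\<^sup>2 / 16 * (1 / 4 ^ n) * (exp (- 4) / exp 4 ^ n))"
    by (simp add: inner_volume_def power_mult_distrib ac_simps)
  also have "\<dots> \<le> N ^ (2 * n) * (pi\<^sup>2 / 16 * (1 / N)\<^sup>2 * (exp (- 4) / exp 4 ^ n))"
    using \<open>1 / 4 ^ n \<le> (1 / N)\<^sup>2\<close> f N by (intro mult_mono mult_left_mono mult_right_mono) auto
  also have "\<dots> = N ^ (2 * n) * (pi\<^sup>2 / 16 * (1 / N)\<^sup>2 * exp (- 4 * N))"
    unfolding \<open>exp (- 4 * N) = exp (- 4) / exp 4 ^ n\<close> ..
  finally show ?thesis using 1 by linarith
qed

lemma monomial_norm_sq_pos: "0 < monomial_norm_sq k"
proof (cases k rule: int_cases2)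
  case (nonneg n)
  have "0 < inner_volume / 4 ^ n" using inner_volume_pos by simp
  then show ?thesis using monomial_norm_sq_nonneg_ge[of n] nonneg by simp
next
  case (nonpos n)
  have "0 < inner_volume * (fact n)\<^sup>2 / (4 * exp 4) ^ n" using inner_volume_pos by simp
  then show ?thesis using monomial_norm_sq_neg_ge[of n] nonpos by (simp only:)
qed

text \<open>The bound on the coefficient of \<open>w\<^sup>-\<^sup>k\<close> in the image of a function of norm 1; see
  \<open>norm_friedrichs_coeff_le\<close>.\<close>

definition friedrichs_size :: "int \<Rightarrow> real" where
  "friedrichs_size k = monomial_norm_sq 0 / (sqrt (monomial_norm_sq k) * monomial_norm_sq (- k))"

lemma friedrichs_size_nonneg: "0 \<le> friedrichs_size k"
  by (simp add: friedrichs_size_def monomial_norm_sq_pos less_imp_le)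

lemma friedrichs_size_nonpos_le:
  obtains K B where "0 \<le> K" "0 \<le> B" "\<And>n. friedrichs_size (- int n) \<le> K * (B ^ n / fact n)"
proof
  let ?K = "monomial_norm_sq 0 / (sqrt inner_volume * inner_volume)" and ?B = "8 * exp 2 :: real"
  show "0 \<le> ?K" "0 \<le> ?B"
    using inner_volume_pos monomial_norm_sq_pos[of 0] by auto
  fix n
  have "sqrt (exp 4) = exp (2 :: real)"
    using exp_double[of "2::real"] by simp
  then have "sqrt (inner_volume * (fact n)\<^sup>2 / (4 * exp 4) ^ n) = sqrt inner_volume * fact n / (2 * exp 2) ^ n"
    by (simp add: real_sqrt_mult real_sqrt_divide real_sqrt_power)
  then have "sqrt inner_volume * fact n / (2 * exp 2) ^ n \<le> sqrt (monomial_norm_sq (- int n))"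
    using monomial_norm_sq_neg_ge[of n] by (metis real_sqrt_le_mono)
  then have "friedrichs_size (- int n)
      \<le> monomial_norm_sq 0 / (sqrt inner_volume * fact n / (2 * exp 2) ^ n * (inner_volume / 4 ^ n))"
    unfolding friedrichs_size_def minus_minus
    using monomial_norm_sq_nonneg_ge[of n] inner_volume_pos monomial_norm_sq_pos[of 0]
    by (intro divide_left_mono mult_mono mult_pos_pos) (auto simp: monomial_norm_sq_pos less_imp_le)
  moreover have B: "?B ^ n = (2 * exp 2) ^ n * 4 ^ n"
    unfolding power_mult_distrib[symmetric] by simp
  moreover have "monomial_norm_sq 0 / (sqrt inner_volume * fact n / (2 * exp 2) ^ n * (inner_volume / 4 ^ n))
    = ?K * (?B ^ n / fact n)"
    unfolding B by (simp add: divide_inverse ac_simps)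
  ultimately show "friedrichs_size (- int n) \<le> ?K * (?B ^ n / fact n)" by (simp only:)
qed

text \<open>The size is at most \<open>K B\<^sup>n / (n!)\<^sup>2\<close>. One of the factorials absorbs \<open>(B / \<epsilon>)\<^sup>n\<close>, because
  \<open>(B / \<epsilon>)\<^sup>n / n! \<le> exp (B / \<epsilon>)\<close>.\<close>

lemma friedrichs_size_nonneg_le:
  assumes "0 < \<epsilon>"
  obtains K where "0 \<le> K" "\<And>n. friedrichs_size (int n) \<le> K * (\<epsilon> ^ n / fact n)"
proof
  let ?K = "monomial_norm_sq 0 / (sqrt inner_volume * inner_volume)" and ?B = "8 * exp 4 :: real"
  show "0 \<le> ?K * exp (?B / \<epsilon>)"
    using inner_volume_pos monomial_norm_sq_pos[of 0] by auto
  fix n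
  have "sqrt (inner_volume / 4 ^ n) = sqrt inner_volume / 2 ^ n"
    by (simp add: real_sqrt_divide real_sqrt_power)
  then have "sqrt inner_volume / 2 ^ n \<le> sqrt (monomial_norm_sq (int n))"
    using monomial_norm_sq_nonneg_ge[of n] by (metis real_sqrt_le_mono)
  then have "friedrichs_size (int n)
      \<le> monomial_norm_sq 0 / (sqrt inner_volume / 2 ^ n * (inner_volume * (fact n)\<^sup>2 / (4 * exp 4) ^ n))"
    unfolding friedrichs_size_def
    using monomial_norm_sq_neg_ge[of n] inner_volume_pos monomial_norm_sq_pos[of 0]
    by (intro divide_left_mono mult_mono mult_pos_pos) (auto simp: monomial_norm_sq_pos less_imp_le)
  also have "\<dots> = ?K * (?B ^ n / fact n / fact n)"
  proof -
    have B: "?B ^ n = 2 ^ n * (4 * exp 4) ^ n"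
      unfolding power_mult_distrib[symmetric] by simp
    show ?thesis
      unfolding B by (simp add: power2_eq_square divide_inverse ac_simps)
  qed
  also have "?B ^ n = (?B / \<epsilon>) ^ n * \<epsilon> ^ n"
    unfolding power_mult_distrib[symmetric] using assms by simp
  also have "?K * ((?B / \<epsilon>) ^ n * \<epsilon> ^ n / fact n / fact n)
    = ?K * ((?B / \<epsilon>) ^ n / fact n) * (\<epsilon> ^ n / fact n)"
    by simp
  also have "\<dots> \<le> ?K * exp (?B / \<epsilon>) * (\<epsilon> ^ n / fact n)"
    using power_le_fact_mult_exp[of "?B / \<epsilon>" n] assms \<open>0
      \<le> ?K * exp (?B / \<epsilon>)\<close> inner_volume_pos monomial_norm_sq_pos[of 0]
    by (intro mult_right_mono mult_left_mono) (auto simp: field_simps)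
  finally show "friedrichs_size (int n) \<le> ?K * exp (?B / \<epsilon>) * (\<epsilon> ^ n / fact n)" .
qed

section \<open>The Friedrichs operator as a Laurent series\<close>

text \<open>Used with \<open>x = 1 / \<bar>w\<bar> > 1\<close>: positive powers of \<open>w\<close> are bounded by 1, and the negative ones are
  dominated by the exponential series of \<open>\<epsilon> x\<close>.\<close>

lemma friedrichs_size_series_bound:
  assumes "0 < \<epsilon>"
  obtains C where "0 \<le> C"
    and "\<And>x. 0 \<le> x
      \<Longrightarrow> summable (\<lambda>n. friedrichs_size (- int n) + friedrichs_size (int (Suc n)) * x ^ Suc n)"
    and "\<And>x. 0 \<le> x \<Longrightarrow> (\<Sum>n. friedrichs_size (- int n) + friedrichs_size (int (Suc n)) * x ^ Suc n)
      \<le> C * exp (\<epsilon> * x)"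
proof -
  obtain K1 B where 1: "0 \<le> K1" "0 \<le> B" "\<And>n. friedrichs_size (- int n) \<le> K1 * (B ^ n / fact n)"
    using friedrichs_size_nonpos_le by blast
  obtain K2 where 2: "0 \<le> K2" "\<And>n. friedrichs_size (int n) \<le> K2 * (\<epsilon> ^ n / fact n)"
    using friedrichs_size_nonneg_le[OF assms] by blast
  have exp_sums: "(\<lambda>n. y ^ n / fact n) sums exp y" for y :: real
    using exp_converges[of y] by (simp add: divide_inverse mult.commute)
  have *: "summable (\<lambda>n. friedrichs_size (- int n) + friedrichs_size (int (Suc n)) * x ^ Suc n) \<and>
      (\<Sum>n. friedrichs_size (- int n) + friedrichs_size (int (Suc n)) * x ^ Suc n)
        \<le> (K1 * exp B + K2) * exp (\<epsilon> * x)"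
    if x: "0 \<le> x" for x
  proof -
    let ?f = "\<lambda>n. friedrichs_size (- int n) + friedrichs_size (int (Suc n)) * x ^ Suc n"
    let ?g = "\<lambda>n. K1 * (B ^ n / fact n) + K2 * ((\<epsilon> * x) ^ Suc n / fact (Suc n))"
    have "(\<lambda>n. (\<epsilon> * x) ^ Suc n / fact (Suc n)) sums (exp (\<epsilon> * x) - 1)"
      using exp_sums[of "\<epsilon> * x"] by (subst sums_Suc_iff) simp
    then have g: "?g sums (K1 * exp B + K2 * (exp (\<epsilon> * x) - 1))"
      by (intro sums_add sums_mult exp_sums)
    have le: "?f n \<le> ?g n" for n
    proof -
      have "friedrichs_size (int (Suc n)) * x ^ Suc n \<le> K2 * (\<epsilon> ^ Suc n / fact (Suc n)) * x ^ Suc n"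
        using x by (intro mult_right_mono 2) auto
      also have "\<dots> = K2 * ((\<epsilon> * x) ^ Suc n / fact (Suc n))"
        unfolding power_mult_distrib by simp
      finally show ?thesis using 1(3)[of n] by linarith
    qed
    have "0 \<le> ?f n" for n
      using x by (intro add_nonneg_nonneg mult_nonneg_nonneg friedrichs_size_nonneg) auto
    then have sf: "summable ?f"
      using le by (intro summable_comparison_test'[OF sums_summable[OF g]])
        (simp only: real_norm_def abs_of_nonneg)
    have "suminf ?f \<le> K1 * exp B + K2 * (exp (\<epsilon> * x) - 1)"
      using suminf_le[OF le sf sums_summable[OF g]] sums_unique[OF g] by linarith
    also have "\<dots> \<le> (K1 * exp B) * exp (\<epsilon> * x) + K2 * exp (\<epsilon> * x)"
      using 1 2 x assms mult_left_mono[of 1 "exp (\<epsilon> * x)" "K1 * exp B"] mult_left_mono[of "exp (\<epsilon>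
        * x) - 1" "exp (\<epsilon> * x)" K2]
      by (intro add_mono) auto
    finally show ?thesis using sf by (simp add: distrib_right)
  qed
  show ?thesis
    by (rule that[of "K1 * exp B + K2"]) (use * 1 2 in auto)
qed

text \<open>The coefficient of \<open>w\<^sup>-\<^sup>k\<close>, not of \<open>w\<^sup>k\<close>, in the image of \<open>g\<close>.\<close>

definition friedrichs_coeff :: "(complex2 \<Rightarrow> complex) \<Rightarrow> int \<Rightarrow> complex" where
  "friedrichs_coeff g k =
     cnj (laurent_coeff (\<lambda>w. g (0, w)) k) * (monomial_norm_sq 0 / monomial_norm_sq (- k))"

text \<open>The terms of index \<open>- n\<close> and \<open>n + 1\<close> are paired, so that one sum over the natural numbers runs
  through all integers.\<close>

definition friedrichs_term :: "(complex2 \<Rightarrow> complex) \<Rightarrow> nat \<Rightarrow> complex \<Rightarrow> complex" where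
  "friedrichs_term g n w = friedrichs_coeff g (- int n) * w powi int n
     + friedrichs_coeff g (int (Suc n)) * w powi (- int (Suc n))"

definition friedrichs_series :: "(complex2 \<Rightarrow> complex) \<Rightarrow> complex2 \<Rightarrow> complex" where
  "friedrichs_series g z = (if z \<in> HT then \<Sum>n. friedrichs_term g n (snd z) else 0)"

lemma norm_friedrichs_coeff_le:
  assumes g: "g \<in> A_space 2 HT"
  shows "norm (friedrichs_coeff g k) \<le> Lp_norm 2 HT g * friedrichs_size k"
proof -
  let ?a = "laurent_coeff (\<lambda>w. g (0, w)) k" and ?m = "monomial_norm_sq k"
  have m: "0 < ?m" by (rule monomial_norm_sq_pos)
  have "norm ?a * ?m = norm (LINT z|\<mu>. g z * cnj (snd z powi k))"
    using m unfolding integral_mult_cnj_monomial[OF g] by (simp add: norm_mult)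
  also have "\<dots> \<le> sqrt (LINT z|\<mu>. (norm (g z))\<^sup>2) * sqrt (LINT z|\<mu>. (norm (cnj (snd z powi k)))\<^sup>2)"
    by (rule integral_Cauchy_Schwarz)
      (use A_space_2D[OF g] integrable_HT_norm_powi[of "2 * k"]
        borel_measurable_HT_continuous(1)[OF continuous_on_cnj[OF continuous_on_HT_powi(2)], of k]
        in \<open>simp_all add: norm_powi_square del: complex_cnj_power_int\<close>)
  also have "\<dots> = Lp_norm 2 HT g * sqrt ?m"
    by (simp add: Lp_norm_2 norm_powi_square monomial_norm_sq_def del: complex_cnj_power_int)
  finally have "norm ?a * (sqrt ?m * sqrt ?m) \<le> Lp_norm 2 HT g * sqrt ?m"
    using m by simp
  then have "norm ?a * sqrt ?m \<le> Lp_norm 2 HT g"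
    using m by (simp only: mult.assoc[symmetric]) (simp only: mult_le_cancel_right_pos real_sqrt_gt_zero)
  then have "norm ?a \<le> Lp_norm 2 HT g / sqrt ?m"
    using m by (simp add: pos_le_divide_eq)
  then have "norm ?a * (monomial_norm_sq 0 / monomial_norm_sq (- k))
    \<le> Lp_norm 2 HT g / sqrt ?m * (monomial_norm_sq 0 / monomial_norm_sq (- k))"
    using monomial_norm_sq_pos[of 0] monomial_norm_sq_pos[of "- k"] by (intro mult_right_mono) auto
  then show ?thesis
    using monomial_norm_sq_pos[of 0] monomial_norm_sq_pos[of "- k"]
    by (simp add: friedrichs_coeff_def friedrichs_size_def norm_mult norm_divide)
qed

lemma norm_friedrichs_term_le:
  assumes g: "g \<in> A_space 2 HT" and w: "norm w < 1"
  shows "norm (friedrichs_term g n w) \<le> Lp_norm 2 HT g *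
     (friedrichs_size (- int n) + friedrichs_size (int (Suc n)) * (1 / norm w) ^ Suc n)"
proof -
  let ?N = "Lp_norm 2 HT g"
  have N: "0 \<le> ?N" by (simp add: Lp_norm_2)
  have "norm (friedrichs_coeff g (- int n) * w powi int n) \<le> ?N * friedrichs_size (- int n) * 1"
    unfolding norm_mult power_int_of_nat norm_power
    using w N by (intro mult_mono norm_friedrichs_coeff_le g power_le_one mult_nonneg_nonneg
      friedrichs_size_nonneg) auto
  moreover have "norm (friedrichs_coeff g (int (Suc n)) * w powi (- int (Suc n)))
      \<le> ?N * friedrichs_size (int (Suc n)) * (1 / norm w) ^ Suc n"
    unfolding norm_mult powi_minus_Suc norm_power norm_inverse divide_inverse mult_1_left
    by (intro mult_right_mono norm_friedrichs_coeff_le g) auto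
  ultimately show ?thesis
    unfolding friedrichs_term_def distrib_left
    by (intro norm_triangle_le) (simp only: mult.assoc mult_1_right)
qed

text \<open>The constant depends on \<open>\<epsilon>\<close> alone. The bound on all partial sums is what dominated convergence needs
  in \<open>friedrichs_series_orthogonal\<close>.\<close>

lemma friedrichs_series_bound:
  assumes "0 < \<epsilon>"
  obtains C where "0 \<le> C"
    and "\<And>g z. g \<in> A_space 2 HT \<Longrightarrow> z \<in> HT \<Longrightarrow> summable (\<lambda>n. friedrichs_term g n (snd z))"
    and "\<And>g z m. g \<in> A_space 2 HT \<Longrightarrow> z \<in> HT \<Longrightarrow>
           norm (\<Sum>n<m. friedrichs_term g n (snd z)) \<le> C * Lp_norm 2 HT g * exp (\<epsilon> / norm (snd z))"
    and "\<And>g z. g \<in> A_space 2 HT \<Longrightarrow> z \<in> HT \<Longrightarrow>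
           norm (friedrichs_series g z) \<le> C * Lp_norm 2 HT g * exp (\<epsilon> / norm (snd z))"
proof -
  let ?M = "\<lambda>x n. friedrichs_size (- int n) + friedrichs_size (int (Suc n)) * x ^ Suc n"
  obtain C where C: "0 \<le> C" "\<And>x. 0 \<le> x \<Longrightarrow> summable (?M x)"
    "\<And>x. 0 \<le> x \<Longrightarrow> suminf (?M x) \<le> C * exp (\<epsilon> * x)"
    using friedrichs_size_series_bound[OF assms] by blast
  have *: "summable (\<lambda>n. friedrichs_term g n (snd z))"
      "norm (\<Sum>n<m. friedrichs_term g n (snd z)) \<le> C * Lp_norm 2 HT g * exp (\<epsilon> / norm (snd z))"
    if g: "g \<in> A_space 2 HT" and z: "z \<in> HT" for g z m
  proof -
    let ?x = "1 / norm (snd z)" and ?N = "Lp_norm 2 HT g"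
    have N: "0 \<le> ?N" by (simp add: Lp_norm_2)
    have le: "norm (friedrichs_term g n (snd z)) \<le> ?N * ?M ?x n" for n
      using z by (intro norm_friedrichs_term_le g) (auto simp: mem_HT_iff)
    have s: "summable (\<lambda>n. ?N * ?M ?x n)"
      by (intro summable_mult C) simp
    then have sn: "summable (\<lambda>n. norm (friedrichs_term g n (snd z)))"
      using le by (intro summable_comparison_test'[OF s]) simp
    then show "summable (\<lambda>n. friedrichs_term g n (snd z))"
      by (rule summable_norm_cancel)
    have "norm (\<Sum>n<m. friedrichs_term g n (snd z)) \<le> (\<Sum>n<m. norm (friedrichs_term g n (snd z)))"
      by (rule norm_sum)
    also have "\<dots> \<le> (\<Sum>n. norm (friedrichs_term g n (snd z)))"
      by (rule sum_le_suminf[OF sn]) auto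
    also have "\<dots> \<le> (\<Sum>n. ?N * ?M ?x n)"
      by (rule suminf_le[OF le sn s])
    also have "\<dots> = ?N * suminf (?M ?x)"
      by (rule suminf_mult) (rule C(2), simp)
    also have "\<dots> \<le> ?N * (C * exp (\<epsilon> * ?x))"
      by (intro mult_left_mono C N) simp
    finally show "norm (\<Sum>n<m. friedrichs_term g n (snd z)) \<le> C * ?N * exp (\<epsilon> / norm (snd z))"
      by (simp add: ac_simps)
  qed
  have "norm (friedrichs_series g z) \<le> C * Lp_norm 2 HT g * exp (\<epsilon> / norm (snd z))"
    if g: "g \<in> A_space 2 HT" and z: "z \<in> HT" for g z
  proof (rule Lim_bounded)
    show "(\<lambda>m. norm (\<Sum>n<m. friedrichs_term g n (snd z))) \<longlonglongrightarrow> norm (friedrichs_series g z)"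
      unfolding friedrichs_series_def using z summable_LIMSEQ[OF *(1)[OF g z]]
        by (auto intro: tendsto_norm)
  qed (use *(2)[OF g z] in auto)
  with C(1) * show ?thesis by (intro that)
qed

lemma field_differentiable_powser:
  fixes c :: "nat \<Rightarrow> complex"
  assumes "\<And>n. norm (c n) \<le> K * (B ^ n / fact n)"
  shows "summable (\<lambda>n. c n * w ^ n)" and "(\<lambda>w. \<Sum>n. c n * w ^ n) field_differentiable at w"
proof -
  show s: "summable (\<lambda>n. c n * w ^ n)" for w
  proof (rule summable_comparison_test')
    show "summable (\<lambda>n. K * ((B * norm w) ^ n /\<^sub>R fact n))"
      by (intro summable_mult summable_exp_generic)
    fix n
    have "norm (c n * w ^ n) \<le> K * (B ^ n / fact n) * norm w ^ n"
      unfolding norm_mult norm_power by (intro mult_right_mono assms) auto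
    then show "norm (c n * w ^ n) \<le> K * ((B * norm w) ^ n /\<^sub>R fact n)"
      unfolding power_mult_distrib by (simp add: divide_inverse ac_simps)
  qed
  show "(\<lambda>w. \<Sum>n. c n * w ^ n) field_differentiable at w"
    using termdiffs_strong_converges_everywhere[OF s] by (auto simp: field_differentiable_def)
qed

text \<open>The series is \<open>P(w) + Q(1 / w) / w\<close> for two entire functions \<open>P\<close> and \<open>Q\<close>.\<close>

lemma friedrichs_series_holomorphic:
  assumes g: "g \<in> A_space 2 HT"
  shows "friedrichs_series g \<in> holomorphic_functions HT"
proof -
  obtain K1 B where 1: "0 \<le> K1" "0 \<le> B" "\<And>n. friedrichs_size (- int n) \<le> K1 * (B ^ n / fact n)"
    using friedrichs_size_nonpos_le by blast
  obtain K2 where 2: "0 \<le> K2" "\<And>n. friedrichs_size (int n) \<le> K2 * (1 ^ n / fact n)"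
    using friedrichs_size_nonneg_le[of 1] by auto
  let ?N = "Lp_norm 2 HT g"
  have N: "0 \<le> ?N" by (simp add: Lp_norm_2)
  define P where "P w = (\<Sum>n. friedrichs_coeff g (- int n) * w ^ n)" for w
  define Q where "Q w = (\<Sum>n. friedrichs_coeff g (int (Suc n)) * w ^ n)" for w
  have c1: "norm (friedrichs_coeff g (- int n)) \<le> (?N * K1) * (B ^ n / fact n)" for n
    using norm_friedrichs_coeff_le[OF g, of "- int n"] mult_left_mono[OF 1(3)[of n] N]
      by (simp only: mult.assoc)
  have c2: "norm (friedrichs_coeff g (int (Suc n))) \<le> (?N * K2) * (1 ^ n / fact n)" for n
  proof -
    have "(1 / fact (Suc n) :: real) \<le> 1 / fact n"
      by (intro divide_left_mono) (auto simp del: fact_Suc intro: fact_mono)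
    then have "K2 * (1 ^ Suc n / fact (Suc n)) \<le> K2 * (1 ^ n / fact n)"
      using 2(1) by (intro mult_left_mono) (simp_all del: fact_Suc)
    with 2(2)[of "Suc n"] have "friedrichs_size (int (Suc n)) \<le> K2 * (1 ^ n / fact n)" by linarith
    then show ?thesis
      using norm_friedrichs_coeff_le[OF g, of "int (Suc n)"] mult_left_mono[OF _ N] order_trans
      by (metis mult.assoc)
  qed
  note P = field_differentiable_powser[OF c1, folded P_def[abs_def]]
    and Q = field_differentiable_powser[OF c2, folded Q_def[abs_def]]
  have eq: "P (snd z) + inverse (snd z) * Q (inverse (snd z)) = friedrichs_series g z"
    if z: "z \<in> HT" for z
  proof -
    have "(\<Sum>n. friedrichs_term g n (snd z)) =
       (\<Sum>n. friedrichs_coeff g (- int n) * snd z ^ n + inverse (snd z) * (friedrichs_coeff g (int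
         (Suc n)) * inverse (snd z) ^ n))"
      unfolding friedrichs_term_def powi_minus_Suc power_int_of_nat power_Suc by (simp only: ac_simps)
    also have "\<dots> = P (snd z) + (\<Sum>n. inverse (snd z) * (friedrichs_coeff g (int (Suc n)) * inverse
      (snd z) ^ n))"
      unfolding P_def by (rule suminf_add[symmetric]) (intro P summable_mult Q)+
    also have "(\<Sum>n. inverse (snd z) * (friedrichs_coeff g (int (Suc n)) * inverse (snd z) ^ n))
      = inverse (snd z) * Q (inverse (snd z))"
      unfolding Q_def by (rule suminf_mult) (rule Q)
    finally show ?thesis using z by (simp add: friedrichs_series_def)
  qed
  have "complex_differentiable_at (friedrichs_series g) z" if z: "z \<in> HT" for z
  proof (rule complex_differentiable_at_cong_open[OF _ open_HT z eq])
    have nz: "snd z \<noteq> 0" using z by (auto simp: mem_HT_iff)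
    have inv: "inverse field_differentiable at (snd z)"
      using field_differentiable_inverse[OF field_differentiable_ident nz] by simp
    have "(Q \<circ> inverse) field_differentiable at (snd z)"
      by (rule field_differentiable_compose[OF inv Q(2)])
    then show "complex_differentiable_at (\<lambda>z. P (snd z) + inverse (snd z) * Q (inverse (snd z))) z"
      by (intro complex_differentiable_at_snd[where f="\<lambda>w. P w + inverse w * Q (inverse w)"]
          field_differentiable_add field_differentiable_mult P inv) (simp_all add: o_def)
  qed
  then show ?thesis
    by (auto simp: holomorphic_functions_def friedrichs_series_def)
qed

text \<open>The pointwise bound with \<open>\<epsilon> = 2 / p\<close> has a multiple of \<open>exp (2 / \<bar>w\<bar>)\<close> as its \<open>p\<close>-th power,
  and this is integrable.\<close>

lemma friedrichs_series_Lp: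
  assumes "2 \<le> p"
  obtains C where "\<And>g. g \<in> A_space 2 HT \<Longrightarrow> friedrichs_series g \<in> A_space p HT"
    and "\<And>g. g \<in> A_space 2 HT \<Longrightarrow> Lp_norm p HT (friedrichs_series g) \<le> C * Lp_norm 2 HT g"
proof -
  have p: "0 < p" "0 < 2 / p" using assms by auto
  obtain C where C: "0 \<le> C" "\<And>g z. g \<in> A_space 2 HT \<Longrightarrow> z \<in> HT \<Longrightarrow>
           norm (friedrichs_series g z) \<le> C * Lp_norm 2 HT g * exp (2 / p / norm (snd z))"
    using friedrichs_series_bound[OF p(2)] by metis
  let ?I = "LINT z|\<mu>. exp (2 / norm (snd z))"
  have *: "friedrichs_series g \<in> A_space p HT \<and> Lp_norm p HT (friedrichs_series g)
    \<le> (C * ?I powr (1 / p)) * Lp_norm 2 HT g"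
    if g: "g \<in> A_space 2 HT" for g
  proof -
    let ?N = "Lp_norm 2 HT g" and ?h = "friedrichs_series g"
    have N: "0 \<le> ?N" by (simp add: Lp_norm_2)
    have cont: "continuous_on HT ?h"
      using friedrichs_series_holomorphic[OF g]
      by (intro complex_differentiable_at_imp_continuous) (auto simp: holomorphic_functions_def)
    have le: "norm (?h z) powr p \<le> (C * ?N) powr p * exp (2 / norm (snd z))" if z: "z \<in> HT" for z
    proof -
      have "norm (?h z) powr p \<le> (C * ?N * exp (2 / p / norm (snd z))) powr p"
        using p C(2)[OF g z] by (intro powr_mono2) auto
      also have "\<dots> = (C * ?N) powr p * exp (2 / p / norm (snd z)) powr p"
        by (rule powr_mult)
      also have "exp (2 / p / norm (snd z)) powr p = exp (2 / norm (snd z))"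
        using p by (simp add: exp_powr_real)
      finally show ?thesis .
    qed
    have contp: "continuous_on HT (\<lambda>z. norm (?h z) powr p)"
      using p by (intro continuous_on_powr' continuous_on_norm cont continuous_on_const) auto
    have int: "integrable \<mu> (\<lambda>z. norm (?h z) powr p)"
      by (rule integrable_HT_bound_exp[OF contp]) (use le in auto)
    have "(LINT z|\<mu>. norm (?h z) powr p) \<le> (LINT z|\<mu>. (C * ?N) powr p * exp (2 / norm (snd z)))"
      using le by (intro integral_mono int integrable_mult_right integrable_HT_exp) auto
    also have "\<dots> = (C * ?N) powr p * ?I" by simp
    finally have "Lp_norm p HT ?h \<le> ((C * ?N) powr p * ?I) powr (1 / p)"
      unfolding Lp_norm_def using p by (intro powr_mono2 integral_nonneg_AE) auto
    also have "\<dots> = (C * ?N) * ?I powr (1 / p)"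
      using p C(1) N by (subst powr_mult) (auto simp: powr_powr intro!: integral_nonneg_AE)
    finally have "Lp_norm p HT ?h \<le> (C * ?I powr (1 / p)) * ?N" by (simp only: ac_simps)
    moreover have "?h \<in> A_space p HT"
      using int friedrichs_series_holomorphic[OF g] borel_measurable_HT_continuous(1)[OF cont]
      by (auto simp: A_space_def Lp_space_def)
    ultimately show ?thesis by blast
  qed
  show ?thesis by (rule that[of "C * ?I powr (1 / p)"]) (use * in blast)+
qed

lemma integral_monomial_mult_cnj:
  assumes f: "f \<in> A_space 2 HT"
  shows "integrable \<mu> (\<lambda>z. snd z powi k * cnj (f z))"
    and "(LINT z|\<mu>. snd z powi k * cnj (f z))
      = monomial_norm_sq k * cnj (laurent_coeff (\<lambda>w. f (0, w)) k)"
proof -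
  show "integrable \<mu> (\<lambda>z. snd z powi k * cnj (f z))"
    by (rule integrable_mult_of_square_integrable)
      (use A_space_2D[OF f] integrable_HT_norm_powi[of "2 * k"]
        borel_measurable_HT_continuous(1)[OF continuous_on_cnj, of f]
        borel_measurable_HT_continuous(1)[OF continuous_on_HT_powi(2), of k]
        in \<open>simp_all add: norm_powi_square\<close>)
  have "(LINT z|\<mu>. snd z powi k * cnj (f z)) = (LINT z|\<mu>. cnj (f z * cnj (snd z powi k)))"
    by (simp add: mult.commute)
  also have "\<dots> = cnj (LINT z|\<mu>. f z * cnj (snd z powi k))"
    by (rule Bochner_Integration.integral_cnj)
  finally show "(LINT z|\<mu>. snd z powi k * cnj (f z))
    = monomial_norm_sq k * cnj (laurent_coeff (\<lambda>w. f (0, w)) k)"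
    unfolding integral_mult_cnj_monomial[OF f] by simp
qed

lemma integral_friedrichs_term:
  fixes f g :: "complex2 \<Rightarrow> complex"
  assumes f: "f \<in> A_space 2 HT"
  defines "a \<equiv> laurent_coeff (\<lambda>w. g (0, w))" and "b \<equiv> laurent_coeff (\<lambda>w. f (0, w))"
  shows "integrable \<mu> (\<lambda>z. friedrichs_term g n (snd z) * cnj (f z))"
    and "(LINT z|\<mu>. friedrichs_term g n (snd z) * cnj (f z))
       = monomial_norm_sq 0 * cnj (b (int n) * a (- int n) + b (- int (Suc n)) * a (int (Suc n)))"
proof -
  have eq: "(\<lambda>z. friedrichs_term g n (snd z) * cnj (f z)) =
    (\<lambda>z. friedrichs_coeff g (- int n) * (snd z powi int n * cnj (f z))
       + friedrichs_coeff g (int (Suc n)) * (snd z powi (- int (Suc n)) * cnj (f z)))"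
    unfolding friedrichs_term_def distrib_right mult.assoc ..
  show "integrable \<mu> (\<lambda>z. friedrichs_term g n (snd z) * cnj (f z))"
    unfolding eq by (intro Bochner_Integration.integrable_add integrable_mult_right
      integral_monomial_mult_cnj f)
  have c: "friedrichs_coeff g k * (monomial_norm_sq (- k) * cnj x)
    = monomial_norm_sq 0 * cnj (x * a k)" for k x
    using monomial_norm_sq_pos[of "- k"] by (simp add: friedrichs_coeff_def a_def)
  have "(LINT z|\<mu>. friedrichs_term g n (snd z) * cnj (f z))
    = friedrichs_coeff g (- int n) * (monomial_norm_sq (int n) * cnj (b (int n)))
    + friedrichs_coeff g (int (Suc n)) * (monomial_norm_sq (- int (Suc n)) * cnj (b (- int (Suc n))))"
    unfolding eq b_def integral_monomial_mult_cnj(2)[OF f, symmetric]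
    by (subst Bochner_Integration.integral_add)
      (intro integrable_mult_right integral_monomial_mult_cnj f | simp only: integral_mult_right_zero)+
  also have "\<dots> = monomial_norm_sq 0 * cnj (b (int n) * a (- int n)) + monomial_norm_sq 0 * cnj (b
    (- int (Suc n)) * a (int (Suc n)))"
    using c[of "- int n"] c[of "int (Suc n)"] by (simp only: minus_minus)
  finally show "(LINT z|\<mu>. friedrichs_term g n (snd z) * cnj (f z))
       = monomial_norm_sq 0 * cnj (b (int n) * a (- int n) + b (- int (Suc n)) * a (int (Suc n)))"
    by (simp only: complex_cnj_add distrib_left)
qed

text \<open>Termwise, the left-hand side is the conjugate of the Cauchy product that represents the integral
  of \<open>g f\<close>.\<close>

lemma friedrichs_series_orthogonal:
  assumes g: "g \<in> A_space 2 HT" and f: "f \<in> A_space 2 HT"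
  shows "integrable \<mu> (\<lambda>z. friedrichs_series g z * cnj (f z))"
    and "(LINT z|\<mu>. friedrichs_series g z * cnj (f z)) = (LINT z|\<mu>. cnj (g z) * cnj (f z))"
proof -
  obtain C where C: "0 \<le> C"
    "\<And>z. z \<in> HT \<Longrightarrow> summable (\<lambda>n. friedrichs_term g n (snd z))"
    "\<And>z m. z \<in> HT \<Longrightarrow> norm (\<Sum>n<m. friedrichs_term g n (snd z))
      \<le> C * Lp_norm 2 HT g * exp (1 / norm (snd z))"
    using friedrichs_series_bound[of 1] g by (metis zero_less_one)
  let ?S = "\<lambda>m z. (\<Sum>n<m. friedrichs_term g n (snd z)) * cnj (f z)"
  let ?W = "\<lambda>z. C * Lp_norm 2 HT g * norm (complex_of_real (exp (1 / norm (snd z))) * f z)"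
  let ?a = "laurent_coeff (\<lambda>w. g (0, w))" and ?b = "laurent_coeff (\<lambda>w. f (0, w))"
  have expc: "continuous_on HT (\<lambda>z. complex_of_real (exp (1 / norm (snd z))))"
    by (intro continuous_intros) (auto simp: mem_HT_iff)
  have "integrable \<mu> (\<lambda>z. complex_of_real (exp (1 / norm (snd z))) * f z)"
    by (rule integrable_mult_of_square_integrable)
      (use A_space_2D[OF f] integrable_HT_exp borel_measurable_HT_continuous(1)[OF expc]
        in \<open>simp_all flip: exp_double\<close>)
  then have W: "integrable \<mu> ?W"
    by (intro integrable_mult_right integrable_norm)
  have S_eq: "?S m = (\<lambda>z. \<Sum>n<m. friedrichs_term g n (snd z) * cnj (f z))" for m
    by (simp only: sum_distrib_right)
  have S: "integrable \<mu> (?S m)" for m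
    unfolding S_eq by (intro Bochner_Integration.integrable_sum integral_friedrichs_term f)
  have meas: "(\<lambda>z. friedrichs_series g z * cnj (f z)) \<in> borel_measurable \<mu>"
    using friedrichs_series_holomorphic[OF g] A_space_2D[OF f]
    by (intro borel_measurable_HT_continuous continuous_on_mult continuous_on_cnj
      complex_differentiable_at_imp_continuous)
      (auto simp: holomorphic_functions_def)
  have lim: "AE z in \<mu>. (\<lambda>m. ?S m z) \<longlonglongrightarrow> friedrichs_series g z * cnj (f z)"
    using C(2) by (intro AE_I2 tendsto_mult_right) (auto simp: friedrichs_series_def summable_LIMSEQ)
  have bound: "AE z in \<mu>. norm (?S m z) \<le> ?W z" for m
  proof (rule AE_I2)
    fix z assume "z \<in> space \<mu>"
    then have "norm (?S m z) \<le> C * Lp_norm 2 HT g * exp (1 / norm (snd z)) * norm (f z)"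
      unfolding norm_mult complex_mod_cnj by (intro mult_right_mono C) auto
    then show "norm (?S m z) \<le> ?W z" by (simp add: norm_mult mult.assoc)
  qed
  show "integrable \<mu> (\<lambda>z. friedrichs_series g z * cnj (f z))"
    by (rule integrable_dominated_convergence[OF meas borel_measurable_integrable[OF S] W lim bound])
  have "(\<lambda>m. LINT z|\<mu>. ?S m z) \<longlonglongrightarrow> (LINT z|\<mu>. friedrichs_series g z * cnj (f z))"
    by (rule integral_dominated_convergence[OF meas borel_measurable_integrable[OF S] W lim bound])
  moreover have "(LINT z|\<mu>. ?S m z) = (\<Sum>n<m. monomial_norm_sq 0 *
      cnj (?b (int n) * ?a (- int n) + ?b (- int (Suc n)) * ?a (int (Suc n))))" for m
    unfolding S_eq by (subst Bochner_Integration.integral_sum)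
      (intro integral_friedrichs_term f sum.cong refl)+
  ultimately have 1: "(\<lambda>n. monomial_norm_sq 0 *
      cnj (?b (int n) * ?a (- int n) + ?b (- int (Suc n)) * ?a (int (Suc n)))) sums
      (LINT z|\<mu>. friedrichs_series g z * cnj (f z))"
    unfolding sums_def by (simp only:)
  obtain P Q where PQ: "(\<lambda>n. ?b (int n) * ?a (- int n)) sums P"
    "(\<lambda>n. ?b (- int (Suc n)) * ?a (int (Suc n))) sums Q"
    "laurent_coeff (\<lambda>w. g (0, w) * f (0, w)) 0 = P + Q"
    using laurent_coeff_0_mult_sums[OF holomorphic_slice_snd[OF A_space_2D(1)[OF g]]
        holomorphic_slice_snd[OF A_space_2D(1)[OF f]] zero_less_one] by blast
  have 2: "(\<lambda>n. monomial_norm_sq 0 *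
      cnj (?b (int n) * ?a (- int n) + ?b (- int (Suc n)) * ?a (int (Suc n)))) sums
      (monomial_norm_sq 0 * cnj (P + Q))"
    using sums_add[OF PQ(1,2)] by (intro sums_mult) (simp only: sums_cnj)
  have "(LINT z|\<mu>. cnj (g z) * cnj (f z)) = cnj (LINT z|\<mu>. g z * f z)"
    by (simp flip: Bochner_Integration.integral_cnj)
  also have "\<dots> = monomial_norm_sq 0 * cnj (P + Q)"
    unfolding integral_mult_A_space[OF g f] PQ(3) by simp
  also have "\<dots> = (LINT z|\<mu>. friedrichs_series g z * cnj (f z))"
    by (rule sums_unique2[OF 2 1])
  finally show "(LINT z|\<mu>. friedrichs_series g z * cnj (f z)) = (LINT z|\<mu>. cnj (g z) * cnj (f z))" ..
qed

section \<open>Uniqueness of the projection\<close>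

lemma AE_HT_obtain_in_open:
  assumes AE: "AE z in \<mu>. P z" and U: "open U" "U \<subseteq> HT" "U \<noteq> {}"
  obtains z where "z \<in> U" "P z"
proof -
  have "AE z in lebesgue. z \<in> HT \<longrightarrow> P z"
    using AE by (subst (asm) AE_restrict_space_iff) auto
  then obtain N where N: "{z. \<not> (z \<in> HT \<longrightarrow> P z)} \<subseteq> N" "N \<in> null_sets lebesgue"
    by (auto simp: eventually_ae_filter)
  have "\<not> U \<subseteq> N"
  proof
    assume "U \<subseteq> N"
    with N(2) have "negligible U"
      using negligible_iff_null_sets negligible_subset by blast
    then show False using open_not_negligible U by blast
  qed
  then show ?thesis using N(1) U(2) that by blast
qed

lemma A_space_2_diff:
  assumes f: "f \<in> A_space 2 HT" and g: "g \<in> A_space 2 HT"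
  shows "(\<lambda>z. f z - g z) \<in> A_space 2 HT"
  unfolding A_space_2_iff
proof
  have hol: "\<And>z. z \<in> HT \<Longrightarrow> complex_differentiable_at (\<lambda>z. f z - g z) z"
    using A_space_2D(1)[OF f] A_space_2D(1)[OF g] by (rule complex_differentiable_at_diff)
  then show "(\<lambda>z. f z - g z) \<in> holomorphic_functions HT"
    using A_space_2D(2)[OF f] A_space_2D(2)[OF g] by (simp add: holomorphic_functions_def)
  show "integrable \<mu> (\<lambda>z. (norm (f z - g z))\<^sup>2)"
  proof (rule Bochner_Integration.integrable_bound)
    show "integrable \<mu> (\<lambda>z. 2 * (norm (f z))\<^sup>2 + 2 * (norm (g z))\<^sup>2)"
      using A_space_2D(5)[OF f] A_space_2D(5)[OF g] by simp
    show "(\<lambda>z. (norm (f z - g z))\<^sup>2) \<in> borel_measurable \<mu>"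
      using A_space_2D(4)[OF f] A_space_2D(4)[OF g] by measurable
    have "(norm (f z - g z))\<^sup>2 \<le> 2 * (norm (f z))\<^sup>2 + 2 * (norm (g z))\<^sup>2" for z
    proof -
      have "(norm (f z - g z))\<^sup>2 \<le> (norm (f z) + norm (g z))\<^sup>2"
        by (intro power_mono norm_triangle_ineq4) simp
      also have "\<dots> \<le> 2 * (norm (f z))\<^sup>2 + 2 * (norm (g z))\<^sup>2"
        using sum_squares_bound[of "norm (f z)" "norm (g z)"] by (simp add: power2_sum)
      finally show ?thesis .
    qed
    then show "AE z in \<mu>. norm ((norm (f z - g z))\<^sup>2) \<le> norm (2 * (norm (f z))\<^sup>2 + 2 * (norm (g z))\<^sup>2)"
      by (intro AE_I2) simp
  qed
qed

text \<open>A continuous function that vanishes almost everywhere on an open set vanishes there everywhere.\<close>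

lemma A_space_2_eq_zero:
  assumes d: "d \<in> A_space 2 HT" and zero: "(LINT z|\<mu>. d z * cnj (d z)) = 0"
  shows "d z = 0"
proof (rule ccontr)
  assume "d z \<noteq> 0"
  let ?U = "HT \<inter> d -` (- {0})"
  have U: "open ?U" "?U \<noteq> {}"
    using \<open>d z \<noteq> 0\<close> A_space_2D(2)[OF d, of z] continuous_open_preimage[OF A_space_2D(3)[OF d]
      open_HT, of "- {0}"]
    by auto
  have "(LINT z|\<mu>. d z * cnj (d z)) = (LINT z|\<mu>. complex_of_real ((norm (d z))\<^sup>2))"
    by (simp only: complex_norm_square)
  then have "(LINT z|\<mu>. (norm (d z))\<^sup>2) = 0"
    unfolding zero integral_complex_of_real by simp
  then have "AE z in \<mu>. (norm (d z))\<^sup>2 = 0"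
    using integral_nonneg_eq_0_iff_AE[OF A_space_2D(5)[OF d]] by simp
  then obtain z where "z \<in> ?U" "(norm (d z))\<^sup>2 = 0"
    by (rule AE_HT_obtain_in_open[OF _ U(1) _ U(2)]) auto
  then show False by simp
qed

text \<open>Two candidates for the projection differ by a function in \<open>A\<^sup>2\<close> that is orthogonal to itself. Such a
  function vanishes almost everywhere, and by continuity everywhere.\<close>

lemma friedrichs_operator_eqI:
  assumes g: "g \<in> A_space 2 HT" and h: "h \<in> A_space 2 HT"
    and orth: "\<And>f. f \<in> A_space 2 HT \<Longrightarrow> (LINT z|\<mu>. h z * cnj (f z)) = (LINT z|\<mu>. cnj (g z) * cnj (f z))"
  shows "friedrichs_operator HT g = h"
proof -
  have int: "integrable \<mu> (\<lambda>z. k z * cnj (f z))" if "k \<in> A_space 2 HT" "f \<in> A_space 2 HT" for k f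
    using A_space_2D[OF that(1)] A_space_2D[OF that(2)] borel_measurable_HT_continuous(1)[OF
      continuous_on_cnj, of f]
    by (intro integrable_mult_of_square_integrable) simp_all
  have intg: "integrable \<mu> (\<lambda>z. cnj (g z) * cnj (f z))" if "f \<in> A_space 2 HT" for f
    using A_space_2D[OF g] A_space_2D[OF that] borel_measurable_HT_continuous(1)[OF
      continuous_on_cnj, of f]
      borel_measurable_HT_continuous(1)[OF continuous_on_cnj, of g]
    by (intro integrable_mult_of_square_integrable) simp_all
  have inner: "L2_inner HT (\<lambda>z. cnj (g z) - k z) f
    = (LINT z|\<mu>. cnj (g z) * cnj (f z)) - (LINT z|\<mu>. k z * cnj (f z))"
    if "k \<in> A_space 2 HT" "f \<in> A_space 2 HT" for k f
    unfolding L2_inner_def left_diff_distrib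
    by (rule Bochner_Integration.integral_diff[OF intg[OF that(2)] int[OF that]])
  show ?thesis
    unfolding friedrichs_operator_def bergman_projection_def
  proof (rule the_equality)
    show "h \<in> A_space 2 HT \<and> (\<forall>f\<in>A_space 2 HT. L2_inner HT (\<lambda>z. cnj (g z) - h z) f = 0)"
      using h orth by (simp add: inner)
  next
    fix k assume k: "k \<in> A_space 2 HT \<and> (\<forall>f\<in>A_space 2 HT. L2_inner HT (\<lambda>z. cnj (g z) - k z) f = 0)"
    define d where "d z = k z - h z" for z
    have d: "d \<in> A_space 2 HT"
      using A_space_2_diff[of k h] k h by (simp add: d_def[abs_def])
    have "(LINT z|\<mu>. d z * cnj (d z)) = (LINT z|\<mu>. k z * cnj (d z)) - (LINT z|\<mu>. h z * cnj (d z))"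
      unfolding d_def[of "_ :: complex2"] left_diff_distrib
      using int[of k d] int[of h d] k h d by (simp add: d_def[abs_def])
    also have "\<dots> = 0"
      using k d orth[OF d] inner[of k d] by simp
    finally have "d z = 0" for z
      by (rule A_space_2_eq_zero[OF d])
    then show "k = h" by (auto simp: d_def)
  qed
qed

lemma friedrichs_operator_eq_series:
  assumes "g \<in> A_space 2 HT"
  shows "friedrichs_operator HT g = friedrichs_series g"
proof (rule friedrichs_operator_eqI[OF assms])
  show "friedrichs_series g \<in> A_space 2 HT"
    using friedrichs_series_Lp[of 2] assms by (metis order_refl)
qed (rule friedrichs_series_orthogonal[OF assms])

section \<open>Failure for bounded functions\<close>

definition restricted_monomial :: "int \<Rightarrow> complex2 \<Rightarrow> complex" where
  "restricted_monomial k z = (if z \<in> HT then snd z powi k else 0)"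

lemma restricted_monomial_in_A_space: "(\<lambda>z. c * restricted_monomial k z) \<in> A_space 2 HT"
proof -
  have "complex_differentiable_at (\<lambda>z. c * restricted_monomial k z) z" if "z \<in> HT" for z
    by (rule complex_differentiable_at_cong_open[OF complex_differentiable_at_snd[of "\<lambda>w. c
      * w powi k"] open_HT that])
      (use that in \<open>auto simp: restricted_monomial_def mem_HT_iff field_differentiable_def intro!:
        derivative_eq_intros\<close>)
  moreover have "integrable \<mu> (\<lambda>z. (norm (c * restricted_monomial k z))\<^sup>2)"
  proof -
    have "integrable \<mu> (\<lambda>z. (norm c)\<^sup>2 * norm (snd z) powi (2 * k))"
      by (intro integrable_mult_right integrable_HT_norm_powi)
    also have "?this \<longleftrightarrow> ?thesis"
      by (intro Bochner_Integration.integrable_cong refl)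
        (simp add: restricted_monomial_def norm_mult power_mult_distrib norm_powi_square)
    finally show ?thesis .
  qed
  ultimately show ?thesis
    by (simp add: A_space_2_iff holomorphic_functions_def) (simp add: restricted_monomial_def)
qed

text \<open>Tested against \<open>f\<close>, both sides single out the coefficient of \<open>w\<^sup>-\<^sup>1\<close> in \<open>f(0, w)\<close>.\<close>

lemma friedrichs_operator_monomial:
  "friedrichs_operator HT (restricted_monomial 1)
     = (\<lambda>z. complex_of_real (monomial_norm_sq 0 / monomial_norm_sq (- 1)) * restricted_monomial (- 1) z)"
proof (rule friedrichs_operator_eqI)
  let ?\<kappa> = "complex_of_real (monomial_norm_sq 0 / monomial_norm_sq (- 1))"
  show z1: "restricted_monomial 1 \<in> A_space 2 HT"
    using restricted_monomial_in_A_space[of 1 1] by simp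
  show "(\<lambda>z. ?\<kappa> * restricted_monomial (- 1) z) \<in> A_space 2 HT"
    by (rule restricted_monomial_in_A_space)
  fix f assume f: "f \<in> A_space 2 HT"
  let ?b = "laurent_coeff (\<lambda>w. f (0, w)) (- 1)"
  have "(LINT z|\<mu>. ?\<kappa> * restricted_monomial (- 1) z * cnj (f z))
    = (LINT z|\<mu>. ?\<kappa> * (snd z powi (- 1) * cnj (f z)))"
    by (intro Bochner_Integration.integral_cong refl) (simp add: restricted_monomial_def)
  also have "\<dots> = ?\<kappa> * (monomial_norm_sq (- 1) * cnj ?b)"
    by (simp only: integral_mult_right_zero integral_monomial_mult_cnj(2)[OF f])
  also have "\<dots> = monomial_norm_sq 0 * cnj ?b"
    using monomial_norm_sq_pos[of "- 1"] by simp
  finally have 1: "(LINT z|\<mu>. ?\<kappa> * restricted_monomial (- 1) z * cnj (f z))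
    = monomial_norm_sq 0 * cnj ?b" .
  \<comment> \<open>The restricted monomial is 0 off the domain, but a residue at 0 only sees a neighbourhood of 0.\<close>
  have "laurent_coeff (\<lambda>w. f (0, w) * restricted_monomial 1 (0, w)) 0
    = laurent_coeff (\<lambda>w. f (0, w) * w powi 1) 0"
    unfolding laurent_coeff_def
  proof (rule residue_cong[OF _ refl])
    have "eventually (\<lambda>w. w \<in> ball 0 1 - {0}) (at (0 :: complex))"
      by (rule eventually_at_in_open) auto
    then show "\<forall>\<^sub>F w in at 0. f (0, w) * restricted_monomial 1 (0, w) * w powi (- 0 - 1)
      = f (0, w) * w powi 1 * w powi (- 0 - 1)"
      by eventually_elim (auto simp: restricted_monomial_def mem_HT_iff)
  qed
  also have "\<dots> = ?b"
    using laurent_coeff_mult_powi[OF holomorphic_slice_snd[OF A_space_2D(1)[OF f]], of 1 0] by simp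
  finally have "(LINT z|\<mu>. f z * restricted_monomial 1 z) = monomial_norm_sq 0 * ?b"
    using integral_mult_A_space[OF f z1] by simp
  then have "(LINT z|\<mu>. cnj (restricted_monomial 1 z) * cnj (f z)) = monomial_norm_sq 0 * cnj ?b"
    using Bochner_Integration.integral_cnj[of \<mu> "\<lambda>z. f z * restricted_monomial 1 z"]
      by (simp add: mult.commute)
  with 1 show "(LINT z|\<mu>. ?\<kappa> * restricted_monomial (- 1) z * cnj (f z))
    = (LINT z|\<mu>. cnj (restricted_monomial 1 z) * cnj (f z))"
    by simp
qed

lemma inverse_monomial_not_H_infty:
  assumes "0 < \<kappa>"
  shows "(\<lambda>z. complex_of_real \<kappa> * restricted_monomial (- 1) z) \<notin> H_infty HT"
proof
  let ?h = "\<lambda>z. complex_of_real \<kappa> * restricted_monomial (- 1) z"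
  assume "?h \<in> H_infty HT"
  then have meas: "?h \<in> borel_measurable \<mu>" and fin: "esssup \<mu> (\<lambda>z. ereal (norm (?h z))) < \<infinity>"
    by (auto simp: H_infty_def Linfty_space_def)
  obtain R where R: "esssup \<mu> (\<lambda>z. ereal (norm (?h z))) \<le> ereal R"
    using fin by (cases "esssup \<mu> (\<lambda>z. ereal (norm (?h z)))") auto
  have "AE z in \<mu>. ereal (norm (?h z)) \<le> esssup \<mu> (\<lambda>z. ereal (norm (?h z)))"
    by (rule esssup_AE)
  then have AE: "AE z in \<mu>. norm (?h z) \<le> R"
  proof eventually_elim
    case (elim z)
    then have "ereal (norm (?h z)) \<le> ereal R" using R by (rule order_trans)
    then show ?case by simp
  qed
  \<comment> \<open>On the polydisc \<open>\<bar>w\<bar> < t\<close>, so that \<open>\<kappa> / \<bar>w\<bar>\<close> exceeds \<open>\<bar>R\<bar> + 1\<close>.\<close>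
  define t where "t = min 1 (\<kappa> / (\<bar>R\<bar> + 1))"
  have t: "0 < t" "t \<le> 1" using assms by (auto simp: t_def)
  have tR: "t * (\<bar>R\<bar> + 1) \<le> \<kappa>"
    using min.cobounded2[of 1 "\<kappa> / (\<bar>R\<bar> + 1)"] by (simp add: t_def[symmetric] pos_le_divide_eq)
  have "open (inner_polydisc t)" unfolding inner_polydisc_def by (intro open_Times) auto
  moreover have "(0, of_real (3 * t / 4)) \<in> inner_polydisc t" using t by (simp add: inner_polydisc_def)
  ultimately obtain z where z: "z \<in> inner_polydisc t" "norm (?h z) \<le> R"
    using AE_HT_obtain_in_open[OF AE _ inner_polydisc_subset[OF t]] by blast
  note n = inner_polydisc_norm_snd[OF z(1)]
  have "norm (?h z) = \<kappa> / norm (snd z)"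
    using z inner_polydisc_subset[OF t] assms
    by (auto simp: restricted_monomial_def norm_mult power_int_minus norm_inverse divide_inverse)
  then have "\<kappa> \<le> R * norm (snd z)"
    using z(2) n t pos_divide_le_eq[of "norm (snd z)" \<kappa> R] by linarith
  also have "\<dots> \<le> \<bar>R\<bar> * t" using n t by (intro mult_mono) auto
  also have "\<dots> < t * (\<bar>R\<bar> + 1)" using t by (simp add: algebra_simps)
  finally show False using tR by simp
qed

theorem proposition1p6:
  shows "(\<forall>p::real. 2 \<le> p \<longrightarrow>
            bounded_operator
              (A_space 2 exp_hartogs_triangle) (Lp_norm 2 exp_hartogs_triangle)
              (A_space p exp_hartogs_triangle) (Lp_norm p exp_hartogs_triangle)
              (friedrichs_operator exp_hartogs_triangle))
       \<and> \<not> bounded_operator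
              (A_space 2 exp_hartogs_triangle) (Lp_norm 2 exp_hartogs_triangle)
              (H_infty exp_hartogs_triangle) (Linfty_norm exp_hartogs_triangle)
              (friedrichs_operator exp_hartogs_triangle)"
proof (intro conjI allI impI)
  fix p :: real assume "2 \<le> p"
  then show "bounded_operator (A_space 2 HT) (Lp_norm 2 HT) (A_space p HT) (Lp_norm p HT)
    (friedrichs_operator HT)"
    using friedrichs_series_Lp[of p] friedrichs_operator_eq_series
    unfolding bounded_operator_def by metis
next
  have "restricted_monomial 1 \<in> A_space 2 HT"
    using restricted_monomial_in_A_space[of 1 1] by simp
  moreover have "friedrichs_operator HT (restricted_monomial 1) \<notin> H_infty HT"
    unfolding friedrichs_operator_monomial
    by (intro inverse_monomial_not_H_infty divide_pos_pos monomial_norm_sq_pos)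
  ultimately show "\<not> bounded_operator (A_space 2 HT) (Lp_norm 2 HT) (H_infty HT) (Linfty_norm HT)
    (friedrichs_operator HT)"
    unfolding bounded_operator_def by blast
qed

end
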